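(* Let $\alpha\in\ell^2$ and $1<q<\infty$. The Rhaly operator $R_\alpha$ belongs to the Schatten class $\mathcal{S}^q(\ell^2)$ if and only if the sequence $(\sigma_k)_k$ belongs to $\ell^q$.
   Context: $\mathbb{N}=\{0,1,2,\dots\}$; $(R_\alpha f)(k)=\alpha_k\sum_{j=0}^kf(j)$ on $\ell^2$ (square-summable functions $\mathbb{N}\to\mathbb{C}$). $\sigma_k=(\sum_{j=2^k}^{2^{k+1}-1}(j+1)|\alpha_j|^2)^{1/2}$ for $k\in\mathbb{N}$ (and $\sigma_{-1}=|\alpha_0|$). $T\in\mathcal{S}^q(\ell^2)$ means $(a_n(T))_{n\ge1}\in\ell^q$, where $a_{n+1}(T)=\inf\{\|T-P\|:\operatorname{rank}P\le n\}$. *)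

theory Defs
  imports "HOL-Analysis.Analysis"
begin

definition l2 :: "(nat \<Rightarrow> complex) set" where
  "l2 = {f. summable (\<lambda>n. (cmod (f n))^2)}"

definition l2nrm :: "(nat \<Rightarrow> complex) \<Rightarrow> ennreal" where
  "l2nrm f = (if summable (\<lambda>n. (cmod (f n))^2)
              then ennreal (sqrt (\<Sum>n. (cmod (f n))^2)) else \<infinity>)"

definition opnorm :: "((nat \<Rightarrow> complex) \<Rightarrow> (nat \<Rightarrow> complex)) \<Rightarrow> ennreal" where
  "opnorm T = (SUP f \<in> {f. f \<in> l2 \<and> l2nrm f \<le> 1}. l2nrm (T f))"

definition finite_rank_le ::
  "nat \<Rightarrow> ((nat \<Rightarrow> complex) \<Rightarrow> (nat \<Rightarrow> complex)) \<Rightarrow> bool" where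
  "finite_rank_le n P \<longleftrightarrow>
     (\<forall>f\<in>l2. P f \<in> l2) \<and>
     (\<forall>f\<in>l2. \<forall>g\<in>l2. P (\<lambda>k. f k + g k) = (\<lambda>k. P f k + P g k)) \<and>
     (\<forall>f\<in>l2. \<forall>c. P (\<lambda>k. c * f k) = (\<lambda>k. c * P f k)) \<and>
     (\<exists>C::real. \<forall>f\<in>l2. l2nrm (P f) \<le> ennreal C * l2nrm f) \<and>
     (\<exists>v :: nat \<Rightarrow> nat \<Rightarrow> complex. \<forall>f\<in>l2. \<exists>c :: nat \<Rightarrow> complex.
        P f = (\<lambda>k. \<Sum>i<n. c i * v i k))"

text \<open>Approximation numbers: approx_num T n = a_(n+1)(T)
  = inf { ||T - P|| : rank P <= n }.\<close>
definition approx_num ::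
  "((nat \<Rightarrow> complex) \<Rightarrow> (nat \<Rightarrow> complex)) \<Rightarrow> nat \<Rightarrow> ennreal" where
  "approx_num T n = (INF P \<in> {P. finite_rank_le n P}. opnorm (\<lambda>f k. T f k - P f k))"

definition schatten :: "real \<Rightarrow> ((nat \<Rightarrow> complex) \<Rightarrow> (nat \<Rightarrow> complex)) \<Rightarrow> bool" where
  "schatten q T \<longleftrightarrow> (\<forall>n. approx_num T n < \<infinity>) \<and>
     summable (\<lambda>n. (enn2real (approx_num T n)) powr q)"

definition rhaly :: "(nat \<Rightarrow> complex) \<Rightarrow> (nat \<Rightarrow> complex) \<Rightarrow> (nat \<Rightarrow> complex)" where
  "rhaly \<alpha> f = (\<lambda>k. \<alpha> k * (\<Sum>j\<le>k. f j))"

definition rsigma :: "(nat \<Rightarrow> complex) \<Rightarrow> nat \<Rightarrow> real" where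
  "rsigma \<alpha> k = sqrt (\<Sum>j\<in>{2^k..<2^(k+1)}. real (j+1) * (cmod (\<alpha> j))^2)"

text \<open>The full sequence (sigma_k)_(k>=-1), shifted by one: index 0 is sigma_(-1) = |alpha_0|.\<close>
definition rsigma_seq :: "(nat \<Rightarrow> complex) \<Rightarrow> nat \<Rightarrow> real" where
  "rsigma_seq \<alpha> k = (if k = 0 then cmod (\<alpha> 0) else rsigma \<alpha> (k - 1))"

end

theory Submission
  imports Defs "HOL-Library.Function_Algebras" "HOL-Library.Log_Nat"
begin

text \<open>
  Sufficiency: fix \<open>t > 0\<close>. On the dyadic blocks with \<open>\<sigma>\<^sub>k < t\<close> the operator has norm \<open>O(t)\<close> by a
  dyadic Hardy inequality. A block with \<open>\<sigma>\<^sub>k \<ge> t\<close> is cut into at most \<open>3 \<sigma>\<^sub>k / t\<close> intervals such that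
  replacing the partial sum up to \<open>i\<close> by the partial sum up to the left end of the interval containing \<open>i\<close>
  costs at most \<open>t\<close> in norm and leaves one dimension per interval. So the approximation numbers
  are dominated, up to a constant, by the decreasing rearrangement of the array \<open>3 \<sigma>\<^sub>k / m\<close> with
  \<open>m \<ge> 1\<close>, which is \<open>q\<close>-summable because \<open>q > 1\<close>.

  Necessity: on the span of suitable test functions attached to \<open>N\<close> blocks, at mutual distance at
  least 3 and with \<open>\<sigma>\<^sub>k \<ge> s\<close>, the operator is bounded below by \<open>s / 3\<close>. An operator of rank less than
  \<open>N\<close> has a kernel there, so the first \<open>N\<close> approximation numbers are at least \<open>s / 3\<close>.
\<close>

section \<open>Sums and rearrangements\<close>

lemma norm_sum_square_disjoint:
  fixes g :: "'a \<Rightarrow> 'b :: real_normed_vector"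
  assumes "finite K" and disjoint: "\<And>k l. k \<in> K \<Longrightarrow> l \<in> K \<Longrightarrow> k \<noteq> l \<Longrightarrow> g k = 0 \<or> g l = 0"
  shows "(norm (\<Sum>k\<in>K. g k))\<^sup>2 = (\<Sum>k\<in>K. (norm (g k))\<^sup>2)"
proof (cases "\<exists>k\<in>K. g k \<noteq> 0")
  case True
  then obtain k where nonzero: "k \<in> K" "g k \<noteq> 0" by auto
  then have "g l = 0" if "l \<in> K - {k}" for l
    using disjoint[of k l] that by auto
  then show ?thesis
    by (simp add: sum.remove[OF \<open>finite K\<close> nonzero(1)])
qed simp

lemma sum_triangle_swap:
  fixes g :: "nat \<Rightarrow> nat \<Rightarrow> 'a :: comm_monoid_add"
  shows "(\<Sum>i<M. \<Sum>j\<le>i. g i j) = (\<Sum>j<M. \<Sum>i=j..<M. g i j)"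
proof -
  have "(\<Sum>i<M. \<Sum>j\<le>i. g i j) = (\<Sum>i<M. \<Sum>j\<in>{j. j \<in> {..<M} \<and> j \<le> i}. g i j)"
    by (intro sum.cong) auto
  also have "\<dots> = (\<Sum>j<M. \<Sum>i\<in>{i. i \<in> {..<M} \<and> j \<le> i}. g i j)"
    by (rule sum.swap_restrict) auto
  also have "\<dots> = (\<Sum>j<M. \<Sum>i=j..<M. g i j)"
    by (intro sum.cong) auto
  finally show ?thesis .
qed

lemma sum_prod_le_suminf_mult:
  fixes f g :: "nat \<Rightarrow> real"
  assumes "summable f" "summable g" and nonneg: "\<And>k. 0 \<le> f k" "\<And>m. 0 \<le> g m" and "finite F"
  shows "(\<Sum>(k, m)\<in>F. f k * g m) \<le> suminf f * suminf g"
proof -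
  have "(\<Sum>(k, m)\<in>F. f k * g m) \<le> (\<Sum>(k, m)\<in>fst ` F \<times> snd ` F. f k * g m)"
    using \<open>finite F\<close> nonneg by (intro sum_mono2) (auto simp: image_iff, force+)
  also have "\<dots> = sum f (fst ` F) * sum g (snd ` F)"
    by (simp add: sum_product sum.cartesian_product)
  also have "\<dots> \<le> suminf f * suminf g"
    using assms by (intro mult_mono sum_le_suminf sum_nonneg suminf_nonneg) auto
  finally show ?thesis .
qed

lemma le_suminf_powr:
  fixes s :: "nat \<Rightarrow> real"
  assumes "summable (\<lambda>k. s k powr q)" "0 < q" "0 \<le> s k"
  shows "s k \<le> (\<Sum>k. s k powr q) powr (1/q)"
proof -
  have "s k powr q \<le> (\<Sum>k. s k powr q)"
    using sum_le_suminf[OF assms(1), of "{k}"] by simp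
  then have "(s k powr q) powr (1/q) \<le> (\<Sum>k. s k powr q) powr (1/q)"
    using assms(2) by (intro powr_mono2) auto
  then show ?thesis
    using assms(2,3) by (simp add: powr_powr)
qed

lemma sum_le_sum_lessThan_card:
  fixes h :: "'a \<Rightarrow> 'b :: ordered_comm_monoid_add"
  assumes "finite F" and "\<And>G. G \<subseteq> F \<Longrightarrow> G \<noteq> {} \<Longrightarrow> \<exists>x\<in>G. h x \<le> a (card G - 1)"
  shows "sum h F \<le> sum a {..<card F}"
  using assms
proof (induction F rule: finite_remove_induct)
  case (remove F)
  then obtain x where smallest: "x \<in> F" "h x \<le> a (card F - 1)"
    by blast
  have "sum h F = h x + sum h (F - {x})"
    using remove.hyps(1) smallest(1) by (rule sum.remove)
  also have "\<dots> \<le> a (card F - 1) + sum a {..<card (F - {x})}"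
    by (intro add_mono smallest(2) remove.IH[OF smallest(1)] remove.prems) auto
  also have "\<dots> = sum a {..<Suc (card F - 1)}"
    using remove.hyps(1) smallest(1) by (simp add: add.commute)
  also have "Suc (card F - 1) = card F"
    using remove.hyps(1,2) by (simp add: card_gt_0_iff)
  finally show ?case .
qed simp

lemma summable_if_dominated_by_rearrangement:
  fixes a :: "nat \<Rightarrow> real" and v :: "'a \<Rightarrow> real"
  assumes nonneg: "\<And>n. 0 \<le> a n"
    and dominated: "\<And>F. finite F \<Longrightarrow> \<exists>x. x \<notin> F \<and> a (card F) \<le> v x"
    and bounded: "\<And>F. finite F \<Longrightarrow> sum v F \<le> C"
  shows "summable a"
proof (rule summableI_nonneg_bounded[OF nonneg])
  fix M
  have "\<exists>F. finite F \<and> card F = M \<and> sum a {..<M} \<le> sum v F"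
  proof (induction M)
    case 0
    show ?case by (intro exI[of _ "{}"]) simp
  next
    case (Suc M)
    then obtain F where collected: "finite F" "card F = M" "sum a {..<M} \<le> sum v F"
      by blast
    moreover obtain x where "x \<notin> F" "a M \<le> v x"
      using dominated[OF collected(1)] collected(2) by blast
    ultimately show ?case
      by (intro exI[of _ "insert x F"]) auto
  qed
  then show "sum a {..<M} \<le> C"
    using bounded by force
qed

section \<open>The norm of square-summable sequences\<close>

lemma l2nrm_eq_SUP_L2_set:
  "l2nrm f = (SUP M. ennreal (L2_set (\<lambda>i. cmod (f i)) {..<M}))" (is "_ = (SUP M. ennreal (?S M))")
proof (cases "summable (\<lambda>n. (cmod (f n))\<^sup>2)")
  case True
  have "incseq (\<lambda>M. ennreal (?S M))"
    by (intro monoI ennreal_leI) (auto simp: L2_set_def intro!: sum_mono2)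
  then have "(\<lambda>M. ennreal (?S M)) \<longlonglongrightarrow> (SUP M. ennreal (?S M))"
    by (rule LIMSEQ_SUP)
  moreover have "(\<lambda>M. ennreal (?S M)) \<longlonglongrightarrow> ennreal (sqrt (\<Sum>n. (cmod (f n))\<^sup>2))"
    unfolding L2_set_def by (intro tendsto_ennrealI tendsto_real_sqrt summable_LIMSEQ True)
  ultimately show ?thesis
    using True LIMSEQ_unique by (simp add: l2nrm_def)
next
  case False
  have "(SUP M. ennreal (?S M)) = \<infinity>"
  proof (rule ccontr)
    assume "(SUP M. ennreal (?S M)) \<noteq> \<infinity>"
    then obtain C where bound: "0 \<le> C" "(SUP M. ennreal (?S M)) = ennreal C"
      by (cases "SUP M. ennreal (?S M)") auto
    have "(\<Sum>i\<le>n. (cmod (f i))\<^sup>2) \<le> C\<^sup>2" for n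
    proof -
      have "ennreal (?S (Suc n)) \<le> ennreal C"
        unfolding bound(2)[symmetric] by (rule SUP_upper) simp
      then have "?S (Suc n) \<le> C"
        using bound(1) by simp
      then show ?thesis
        unfolding L2_set_def lessThan_Suc_atMost by (rule sqrt_le_D)
    qed
    then have "summable (\<lambda>n. (cmod (f n))\<^sup>2)"
      by (rule bounded_imp_summable[rotated]) simp
    with False show False ..
  qed
  with False show ?thesis
    unfolding l2nrm_def by (simp only: if_False)
qed

lemma L2_set_le_l2nrm:
  assumes "finite I"
  shows "ennreal (L2_set (\<lambda>i. cmod (f i)) I) \<le> l2nrm f"
proof -
  obtain M where "I \<subseteq> {..<M}"
    using assms finite_nat_iff_bounded by blast
  then have "L2_set (\<lambda>i. cmod (f i)) I \<le> L2_set (\<lambda>i. cmod (f i)) {..<M}"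
    by (auto simp: L2_set_def intro!: sum_mono2)
  then show ?thesis
    unfolding l2nrm_eq_SUP_L2_set by (intro SUP_upper2[of M] ennreal_leI) auto
qed

lemma l2nrm_leI:
  assumes "\<And>M. (\<Sum>i<M. (cmod (f i))\<^sup>2) \<le> c"
  shows "l2nrm f \<le> ennreal (sqrt c)"
  unfolding l2nrm_eq_SUP_L2_set L2_set_def
  by (intro SUP_least ennreal_leI) (simp add: assms)

lemma l2nrm_le_mult_l2nrm:
  assumes "0 \<le> c" and truncated_le: "\<And>M. (\<Sum>i<M. (cmod (g i))\<^sup>2) \<le> c\<^sup>2 * (\<Sum>i<M. (cmod (f i))\<^sup>2)"
  shows "l2nrm g \<le> ennreal c * l2nrm f"
  unfolding l2nrm_eq_SUP_L2_set[of g]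
proof (rule SUP_least)
  fix M
  have "L2_set (\<lambda>i. cmod (g i)) {..<M} \<le> sqrt (c\<^sup>2 * (\<Sum>i<M. (cmod (f i))\<^sup>2))"
    unfolding L2_set_def by (intro real_sqrt_le_mono truncated_le)
  also have "\<dots> = c * L2_set (\<lambda>i. cmod (f i)) {..<M}"
    using \<open>0 \<le> c\<close> by (simp add: L2_set_def real_sqrt_mult)
  finally have "ennreal (L2_set (\<lambda>i. cmod (g i)) {..<M}) \<le>
      ennreal c * ennreal (L2_set (\<lambda>i. cmod (f i)) {..<M})"
    using \<open>0 \<le> c\<close> by (simp add: ennreal_mult[symmetric] L2_set_nonneg ennreal_leI)
  also have "\<dots> \<le> ennreal c * l2nrm f"
    by (intro mult_left_mono L2_set_le_l2nrm) auto
  finally show "ennreal (L2_set (\<lambda>i. cmod (g i)) {..<M}) \<le> ennreal c * l2nrm f" .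
qed

lemma l2nrm_scale: "l2nrm (\<lambda>k. c * f k) = ennreal (cmod c) * l2nrm f"
  unfolding l2nrm_eq_SUP_L2_set SUP_mult_left_ennreal
  by (simp add: norm_mult L2_set_right_distrib[symmetric] ennreal_mult L2_set_nonneg)

lemma l2nrm_triangle: "l2nrm (\<lambda>k. f k + g k) \<le> l2nrm f + l2nrm g"
  unfolding l2nrm_eq_SUP_L2_set[of "\<lambda>k. f k + g k"]
proof (rule SUP_least)
  fix M
  have "L2_set (\<lambda>i. cmod (f i + g i)) {..<M} \<le> L2_set (\<lambda>i. cmod (f i) + cmod (g i)) {..<M}"
    by (intro L2_set_mono norm_triangle_ineq) auto
  also have "\<dots> \<le> L2_set (\<lambda>i. cmod (f i)) {..<M} + L2_set (\<lambda>i. cmod (g i)) {..<M}"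
    by (rule L2_set_triangle_ineq)
  finally have "ennreal (L2_set (\<lambda>i. cmod (f i + g i)) {..<M}) \<le>
      ennreal (L2_set (\<lambda>i. cmod (f i)) {..<M}) + ennreal (L2_set (\<lambda>i. cmod (g i)) {..<M})"
    by (simp add: ennreal_plus[symmetric] L2_set_nonneg ennreal_leI del: ennreal_plus)
  also have "\<dots> \<le> l2nrm f + l2nrm g"
    by (intro add_mono L2_set_le_l2nrm) auto
  finally show "ennreal (L2_set (\<lambda>i. cmod (f i + g i)) {..<M}) \<le> l2nrm f + l2nrm g" .
qed

lemma l2nrm_zero [simp]: "l2nrm (\<lambda>_. 0) = 0"
  by (simp add: l2nrm_def)

lemma l2nrm_sum_le: "l2nrm (\<lambda>j. \<Sum>k\<in>K. f k j) \<le> (\<Sum>k\<in>K. l2nrm (f k))"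
proof (induction K rule: infinite_finite_induct)
  case (insert k K)
  have "l2nrm (\<lambda>j. \<Sum>k\<in>insert k K. f k j) \<le> l2nrm (f k) + l2nrm (\<lambda>j. \<Sum>k\<in>K. f k j)"
    using insert.hyps by (simp add: l2nrm_triangle)
  also have "\<dots> \<le> (\<Sum>k\<in>insert k K. l2nrm (f k))"
    using insert by (simp add: add_left_mono)
  finally show ?case .
qed auto

lemma l2nrm_lincomb_le:
  assumes "\<And>r. r \<in> R \<Longrightarrow> ennreal (cmod (c r)) \<le> C r * N"
  shows "l2nrm (\<lambda>k. \<Sum>r\<in>R. c r * v r k) \<le> (\<Sum>r\<in>R. C r * l2nrm (v r)) * N"
proof -
  have "l2nrm (\<lambda>k. \<Sum>r\<in>R. c r * v r k) \<le> (\<Sum>r\<in>R. ennreal (cmod (c r)) * l2nrm (v r))"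
    using l2nrm_sum_le[of "\<lambda>r k. c r * v r k" R] by (simp add: l2nrm_scale)
  also have "\<dots> \<le> (\<Sum>r\<in>R. C r * N * l2nrm (v r))"
    by (intro sum_mono mult_right_mono assms) auto
  finally show ?thesis
    by (simp add: sum_distrib_left sum_distrib_right mult_ac)
qed

lemma cmod_le_l2nrm: "ennreal (cmod (f j)) \<le> l2nrm f"
  using L2_set_le_l2nrm[of "{j}" f] by simp

lemma l2nrm_eq_0_iff: "l2nrm f = 0 \<longleftrightarrow> f = (\<lambda>_. 0)"
proof
  assume "l2nrm f = 0"
  then show "f = (\<lambda>_. 0)"
    using cmod_le_l2nrm[of f] by (simp add: fun_eq_iff)
qed simp

lemma in_l2_iff_l2nrm_finite: "f \<in> l2 \<longleftrightarrow> l2nrm f < \<infinity>"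
  by (simp add: l2_def l2nrm_def)

lemma l2_scale: "f \<in> l2 \<Longrightarrow> (\<lambda>k. c * f k) \<in> l2"
  by (simp add: in_l2_iff_l2nrm_finite l2nrm_scale ennreal_mult_less_top)

lemma l2_sum: "(\<And>k. k \<in> K \<Longrightarrow> f k \<in> l2) \<Longrightarrow> (\<lambda>j. \<Sum>k\<in>K. f k j) \<in> l2"
  unfolding in_l2_iff_l2nrm_finite
  by (rule le_less_trans[OF l2nrm_sum_le]) (cases "finite K", auto)

lemma l2_if_finite_support: "finite {j. f j \<noteq> 0} \<Longrightarrow> f \<in> l2"
  unfolding l2_def by (auto intro!: summable_finite)

section \<open>Operator norms and approximation numbers\<close>

lemma opnorm_leI: "(\<And>f. f \<in> l2 \<Longrightarrow> l2nrm (T f) \<le> c * l2nrm f) \<Longrightarrow> opnorm T \<le> c"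
  unfolding opnorm_def
  by (intro SUP_least) (metis (mono_tags) mem_Collect_eq mult.right_neutral mult_left_mono order_trans zero_le)

lemma l2nrm_le_opnorm:
  assumes homogeneous: "\<And>c. T (\<lambda>k. c * f k) = (\<lambda>k. c * T f k)" and f_l2: "f \<in> l2"
  shows "l2nrm (T f) \<le> opnorm T * l2nrm f"
proof (cases "f = (\<lambda>_. 0)")
  case True
  with homogeneous[of 0] show ?thesis by simp
next
  case False
  obtain N where norm_f: "0 \<le> N" "l2nrm f = ennreal N"
    using f_l2 by (cases "l2nrm f") (auto simp: in_l2_iff_l2nrm_finite)
  with False have norm_pos: "0 < N"
    using l2nrm_eq_0_iff[of f] by (cases "N = 0") auto
  define c where "c = complex_of_real (1 / N)"
  have normalizer: "ennreal (cmod c) * ennreal N = 1"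
    using norm_pos by (simp add: c_def norm_divide ennreal_mult[symmetric])
  then have "l2nrm (\<lambda>k. c * f k) \<le> 1"
    by (simp add: l2nrm_scale norm_f(2))
  then have "l2nrm (T (\<lambda>k. c * f k)) \<le> opnorm T"
    unfolding opnorm_def using l2_scale[OF f_l2] by (intro SUP_upper) simp
  then have "ennreal (cmod c) * l2nrm (T f) \<le> opnorm T"
    by (simp add: homogeneous l2nrm_scale)
  then have "ennreal N * (ennreal (cmod c) * l2nrm (T f)) \<le> ennreal N * opnorm T"
    by (rule mult_left_mono) simp
  also have "ennreal N * (ennreal (cmod c) * l2nrm (T f)) = l2nrm (T f)"
    using normalizer by (metis mult.assoc mult.commute mult_1)
  finally show ?thesis
    by (simp add: norm_f(2) mult.commute)
qed

lemma opnorm_triangle: "opnorm (\<lambda>f k. S f k + T f k) \<le> opnorm S + opnorm T"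
  unfolding opnorm_def[of "\<lambda>f k. S f k + T f k"]
proof (rule SUP_least)
  fix f assume "f \<in> {f. f \<in> l2 \<and> l2nrm f \<le> 1}"
  then have "l2nrm (S f) \<le> opnorm S" "l2nrm (T f) \<le> opnorm T"
    unfolding opnorm_def by (auto intro: SUP_upper)
  then show "l2nrm (\<lambda>k. S f k + T f k) \<le> opnorm S + opnorm T"
    using l2nrm_triangle[of "S f" "T f"] by (meson add_mono order_trans)
qed

lemma approx_num_le: "finite_rank_le n P \<Longrightarrow> approx_num T n \<le> opnorm (\<lambda>f k. T f k - P f k)"
  unfolding approx_num_def by (rule INF_lower) simp

lemma approx_num_add_le: "approx_num (\<lambda>f k. S f k + T f k) n \<le> opnorm S + approx_num T n"
proof (cases "opnorm S = \<infinity>")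
  case False
  have "approx_num (\<lambda>f k. S f k + T f k) n - opnorm S \<le> approx_num T n"
    unfolding approx_num_def[of T]
  proof (rule INF_greatest)
    fix P assume "P \<in> {P. finite_rank_le n P}"
    then have "approx_num (\<lambda>f k. S f k + T f k) n \<le> opnorm (\<lambda>f k. S f k + T f k - P f k)"
      by (intro approx_num_le) simp
    also have "\<dots> \<le> opnorm S + opnorm (\<lambda>f k. T f k - P f k)"
      using opnorm_triangle[of S "\<lambda>f k. T f k - P f k"] by (simp add: add_diff_eq)
    finally show "approx_num (\<lambda>f k. S f k + T f k) n - opnorm S \<le> opnorm (\<lambda>f k. T f k - P f k)"
      using False by (simp add: ennreal_minus_le_iff)
  qed
  then show ?thesis
    using False by (simp add: ennreal_minus_le_iff)
qed simp

lemma finite_rank_le_add: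
  "finite_rank_le n P \<Longrightarrow> f \<in> l2 \<Longrightarrow> g \<in> l2 \<Longrightarrow> P (\<lambda>k. f k + g k) = (\<lambda>k. P f k + P g k)"
  unfolding finite_rank_le_def by blast

lemma finite_rank_le_scale:
  "finite_rank_le n P \<Longrightarrow> f \<in> l2 \<Longrightarrow> P (\<lambda>k. c * f k) = (\<lambda>k. c * P f k)"
  unfolding finite_rank_le_def by blast

lemma finite_rank_le_lincomb:
  assumes rank_P: "finite_rank_le n P" and "finite K" and "\<And>k. k \<in> K \<Longrightarrow> e k \<in> l2"
  shows "P (\<lambda>j. \<Sum>k\<in>K. x k * e k j) = (\<lambda>j. \<Sum>k\<in>K. x k * P (e k) j)"
  using assms(2,3)
proof (induction K rule: finite_induct)
  case empty
  have "(\<lambda>_. 0) \<in> l2" by (simp add: l2_def)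
  from finite_rank_le_scale[OF rank_P this, of 0] show ?case by simp
next
  case (insert k K)
  have "P (\<lambda>j. \<Sum>k\<in>insert k K. x k * e k j) = P (\<lambda>j. x k * e k j + (\<Sum>k\<in>K. x k * e k j))"
    using insert.hyps by simp
  also have "\<dots> = (\<lambda>j. P (\<lambda>j. x k * e k j) j + P (\<lambda>j. \<Sum>k\<in>K. x k * e k j) j)"
    using insert.prems by (intro finite_rank_le_add[OF rank_P] l2_scale l2_sum) auto
  also have "P (\<lambda>j. x k * e k j) = (\<lambda>j. x k * P (e k) j)"
    using insert.prems by (intro finite_rank_le_scale[OF rank_P]) auto
  finally show ?case
    using insert by simp
qed

lemma finite_rank_leI:
  fixes \<phi> :: "'r \<Rightarrow> (nat \<Rightarrow> complex) \<Rightarrow> complex"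
  assumes rank: "finite R" "card R \<le> n" and v_l2: "\<And>r. r \<in> R \<Longrightarrow> v r \<in> l2"
    and add: "\<And>r f g. r \<in> R \<Longrightarrow> \<phi> r (\<lambda>k. f k + g k) = \<phi> r f + \<phi> r g"
    and scale: "\<And>r f c. r \<in> R \<Longrightarrow> \<phi> r (\<lambda>k. c * f k) = c * \<phi> r f"
    and bounded: "\<And>r f. r \<in> R \<Longrightarrow> ennreal (cmod (\<phi> r f)) \<le> ennreal (C r) * l2nrm f"
  shows "finite_rank_le n (\<lambda>f k. \<Sum>r\<in>R. \<phi> r f * v r k)" (is "finite_rank_le n ?P")
  unfolding finite_rank_le_def
proof (intro conjI ballI allI)
  show "?P f \<in> l2" for f
    by (intro l2_sum l2_scale v_l2)
  show "?P (\<lambda>k. f k + g k) = (\<lambda>k. ?P f k + ?P g k)" for f g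
    by (simp add: add distrib_right sum.distrib)
  show "?P (\<lambda>k. c * f k) = (\<lambda>k. c * ?P f k)" for f c
    by (simp add: scale sum_distrib_left mult.assoc)
  define D where "D = (\<Sum>r\<in>R. ennreal (C r) * l2nrm (v r))"
  have "D < \<infinity>"
    using v_l2 rank(1) by (simp add: D_def in_l2_iff_l2nrm_finite ennreal_mult_less_top)
  then obtain d where D_eq: "D = ennreal d"
    by (cases D) auto
  have "l2nrm (?P f) \<le> D * l2nrm f" for f
    unfolding D_def by (intro l2nrm_lincomb_le bounded)
  then show "\<exists>d. \<forall>f\<in>l2. l2nrm (?P f) \<le> ennreal d * l2nrm f"
    unfolding D_eq by blast
  obtain r where enumeration: "bij_betw r {..<card R} R"
    using rank(1) ex_bij_betw_nat_finite[of R] by (auto simp: atLeast0LessThan)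
  show "\<exists>w. \<forall>f\<in>l2. \<exists>c. ?P f = (\<lambda>k. \<Sum>i<n. c i * w i k)"
  proof (intro exI ballI ext)
    fix f k
    have "?P f k = (\<Sum>i<card R. \<phi> (r i) f * v (r i) k)"
      by (rule sum.reindex_bij_betw[OF enumeration, symmetric])
    also have "\<dots> = (\<Sum>i<n. \<phi> (r i) f * (if i < card R then v (r i) k else 0))"
      using rank(2) by (intro sum.mono_neutral_cong_left) auto
    finally show "?P f k = (\<Sum>i<n. \<phi> (r i) f * (if i < card R then v (r i) k else 0))" .
  qed
qed

lemma approx_num_le_opnorm: "approx_num T n \<le> opnorm T"
proof -
  have "finite_rank_le n (\<lambda>f k. 0)"
    using finite_rank_leI[of "{}" n] by simp
  from approx_num_le[OF this, of T] show ?thesis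
    by simp
qed

lemma (in vector_space) ex_nontrivial_relation:
  assumes "finite K" "finite B" "card B < card K" and span: "g ` K \<subseteq> span B"
  shows "\<exists>x. (\<exists>k\<in>K. x k \<noteq> 0) \<and> (\<Sum>k\<in>K. scale (x k) (g k)) = 0"
proof (cases "inj_on g K")
  case True
  then have "card B < card (g ` K)"
    using assms by (simp add: card_image)
  then have "dependent (g ` K)"
    using independent_span_bound[OF \<open>finite B\<close> _ span] by linarith
  then obtain u where "\<exists>v\<in>g ` K. u v \<noteq> 0" "(\<Sum>v\<in>g ` K. scale (u v) v) = 0"
    using dependent_finite[of "g ` K"] \<open>finite K\<close> by auto
  then show ?thesis
    using True by (intro exI[of _ "u \<circ> g"]) (simp add: sum.reindex)
next
  case False
  then obtain k l where collision: "k \<in> K" "l \<in> K" "k \<noteq> l" "g k = g l"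
    by (auto simp: inj_on_def)
  define x :: "_ \<Rightarrow> 'a" where "x i = (if i = k then 1 else if i = l then -1 else 0)" for i
  have "(\<Sum>i\<in>K. scale (x i) (g i)) = (\<Sum>i\<in>{k, l}. scale (x i) (g i))"
    using collision \<open>finite K\<close> by (intro sum.mono_neutral_right) (auto simp: x_def)
  also have "\<dots> = 0"
    using collision by (simp add: x_def)
  finally show ?thesis
    using collision by (intro exI[of _ x]) (auto simp: x_def)
qed

lemma sum_fun_apply: "(\<Sum>k\<in>K. f k) j = (\<Sum>k\<in>K. f k j)"
  by (induction K rule: infinite_finite_induct) auto

lemma vector_space_fun: "vector_space (\<lambda>(c :: 'b :: field) (f :: 'a \<Rightarrow> 'b) k. c * f k)"
  by unfold_locales (simp_all add: fun_eq_iff algebra_simps)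

lemma finite_rank_le_kernel:
  assumes rank_P: "finite_rank_le n P" and dimension: "finite K" "n < card K" and e_l2: "\<And>k. k \<in> K \<Longrightarrow> e k \<in> l2"
  shows "\<exists>x. (\<exists>k\<in>K. x k \<noteq> 0) \<and> P (\<lambda>j. \<Sum>k\<in>K. x k * e k j) = (\<lambda>_. 0)"
proof -
  interpret vector_space "\<lambda>(c :: complex) (f :: nat \<Rightarrow> complex) k. c * f k"
    by (rule vector_space_fun)
  obtain v where range_P: "\<forall>f\<in>l2. \<exists>c. P f = (\<lambda>k. \<Sum>i<n. c i * v i k)"
    using rank_P unfolding finite_rank_le_def by blast
  have "P f \<in> span (v ` {..<n})" if f_l2: "f \<in> l2" for f
  proof -
    obtain c where "P f = (\<lambda>k. \<Sum>i<n. c i * v i k)"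
      using range_P f_l2 by blast
    then have "P f = (\<Sum>i<n. (\<lambda>k. c i * v i k))"
      by (simp add: fun_eq_iff sum_fun_apply)
    moreover have "(\<lambda>k. c i * v i k) \<in> span (v ` {..<n})" if "i < n" for i
      using span_scale[OF span_base, of "v i" "v ` {..<n}" "c i"] that by simp
    ultimately show ?thesis
      by (auto intro: span_sum)
  qed
  then have "(\<lambda>k. P (e k)) ` K \<subseteq> span (v ` {..<n})"
    using e_l2 by blast
  moreover have "card (v ` {..<n}) < card K"
    using dimension(2) card_image_le[of "{..<n}" v] by simp
  ultimately obtain x where "\<exists>k\<in>K. x k \<noteq> 0" "(\<Sum>k\<in>K. (\<lambda>j. x k * P (e k) j)) = 0"
    using ex_nontrivial_relation[of K "v ` {..<n}" "\<lambda>k. P (e k)"] dimension(1) by auto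
  then show ?thesis
    using finite_rank_le_lincomb[OF rank_P dimension(1) e_l2] by (auto simp: fun_eq_iff sum_fun_apply)
qed

lemma approx_num_ge_if_bounded_below:
  assumes homogeneous: "\<And>f c. f \<in> l2 \<Longrightarrow> T (\<lambda>k. c * f k) = (\<lambda>k. c * T f k)"
    and dimension: "finite K" "n < card K" and e_l2: "\<And>k. k \<in> K \<Longrightarrow> e k \<in> l2"
    and independent: "\<And>x. \<exists>k\<in>K. x k \<noteq> 0 \<Longrightarrow> (\<lambda>j. \<Sum>k\<in>K. x k * e k j) \<noteq> (\<lambda>_. 0)"
    and below: "\<And>x. c * l2nrm (\<lambda>j. \<Sum>k\<in>K. x k * e k j) \<le> l2nrm (T (\<lambda>j. \<Sum>k\<in>K. x k * e k j))"
  shows "c \<le> approx_num T n"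
  unfolding approx_num_def
proof (rule INF_greatest)
  fix P assume "P \<in> {P. finite_rank_le n P}"
  then have rank_P: "finite_rank_le n P" by simp
  obtain x where kernel: "\<exists>k\<in>K. x k \<noteq> 0" "P (\<lambda>j. \<Sum>k\<in>K. x k * e k j) = (\<lambda>_. 0)"
    using finite_rank_le_kernel[OF rank_P dimension, of e] e_l2 by blast
  define f where "f = (\<lambda>j. \<Sum>k\<in>K. x k * e k j)"
  have f_l2: "f \<in> l2"
    unfolding f_def by (intro l2_sum l2_scale e_l2)
  have "c * l2nrm f \<le> l2nrm (\<lambda>k. T f k - P f k)"
    using below[of x] kernel(2) by (simp add: f_def)
  also have "\<dots> \<le> opnorm (\<lambda>f k. T f k - P f k) * l2nrm f"
    by (rule l2nrm_le_opnorm) (simp_all add: homogeneous finite_rank_le_scale[OF rank_P] f_l2 right_diff_distrib)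
  finally have "l2nrm f * c \<le> l2nrm f * opnorm (\<lambda>f k. T f k - P f k)"
    by (simp add: mult.commute)
  moreover have "l2nrm f \<noteq> 0" "l2nrm f < \<infinity>"
    using independent[OF kernel(1)] f_l2 l2nrm_eq_0_iff[of f] by (auto simp: f_def in_l2_iff_l2nrm_finite)
  ultimately show "c \<le> opnorm (\<lambda>f k. T f k - P f k)"
    by (simp add: ennreal_mult_le_mult_iff)
qed

section \<open>Dyadic blocks and Hardy's inequality\<close>

definition dyadic_block :: "nat \<Rightarrow> nat set" where
  "dyadic_block k = {i. floorlog 2 i = k}"

lemma in_dyadic_block_iff: "i \<in> dyadic_block k \<longleftrightarrow> floorlog 2 i = k"
  by (simp add: dyadic_block_def)

lemma dyadic_block_0: "dyadic_block 0 = {0}"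
  by (auto simp: dyadic_block_def floorlog_eq_zero_iff)

lemma dyadic_block_Suc: "dyadic_block (Suc k) = {2^k..<2^Suc k}"
proof (rule set_eqI)
  fix i
  have "floorlog 2 i = Suc k \<longleftrightarrow> floorlog 2 i \<le> Suc k \<and> \<not> floorlog 2 i \<le> k"
    by linarith
  also have "\<dots> \<longleftrightarrow> i \<in> {2^k..<2^Suc k}"
    unfolding floorlog_le_iff by auto
  finally show "i \<in> dyadic_block (Suc k) \<longleftrightarrow> i \<in> {2^k..<2^Suc k}"
    by (simp add: in_dyadic_block_iff)
qed

lemma greaterThanAtMost_subset_dyadic_block:
  assumes "floorlog 2 i = floorlog 2 j"
  shows "{i<..j} \<subseteq> dyadic_block (floorlog 2 j)"
proof
  fix l assume "l \<in> {i<..j}"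
  then show "l \<in> dyadic_block (floorlog 2 j)"
    using floorlog_mono[of i l 2] floorlog_mono[of l j 2] assms by (simp add: in_dyadic_block_iff)
qed

lemma finite_dyadic_block [simp]: "finite (dyadic_block k)"
  by (cases k) (simp_all add: dyadic_block_0 dyadic_block_Suc)

lemma card_dyadic_block: "0 < k \<Longrightarrow> card (dyadic_block k) = 2^(k - 1)"
  by (cases k) (simp_all add: dyadic_block_Suc)

lemma card_dyadic_block_le:
  assumes "i \<in> dyadic_block k"
  shows "card (dyadic_block k) \<le> i + 1"
  using assms by (cases k) (auto simp: dyadic_block_0 dyadic_block_Suc)

lemma dyadic_block_bounds:
  assumes "i \<in> dyadic_block k"
  shows "2^k \<le> 2 * real (i + 1)" "real (i + 1) \<le> 2^k"
proof -
  have "i < 2^k" "2^k \<le> 2 * (i + 1)"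
    using assms by (cases k; simp add: dyadic_block_0 dyadic_block_Suc)+
  then have "real (2^k) \<le> real (2 * (i + 1))" "real (i + 1) \<le> real (2^k)"
    unfolding of_nat_le_iff by simp_all
  then show "2^k \<le> 2 * real (i + 1)" "real (i + 1) \<le> 2^k"
    unfolding of_nat_power of_nat_mult of_nat_numeral .
qed

lemma rsigma_seq_square:
  "(rsigma_seq \<alpha> k)\<^sup>2 = (\<Sum>i\<in>dyadic_block k. real (i+1) * (cmod (\<alpha> i))\<^sup>2)"
proof (cases k)
  case (Suc m)
  have "(rsigma \<alpha> m)\<^sup>2 = (\<Sum>i\<in>{2^m..<2^(m+1)}. real (i+1) * (cmod (\<alpha> i))\<^sup>2)"
    unfolding rsigma_def by (intro real_sqrt_pow2 sum_nonneg) auto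
  with Suc show ?thesis
    by (simp add: rsigma_seq_def dyadic_block_Suc)
qed (simp add: rsigma_seq_def dyadic_block_0)

lemma rsigma_seq_nonneg: "0 \<le> rsigma_seq \<alpha> k"
  by (auto simp: rsigma_seq_def rsigma_def intro!: sum_nonneg)

lemma rsigma_seq_square_le: "(rsigma_seq \<alpha> k)\<^sup>2 \<le> 2^k * (\<Sum>i\<in>dyadic_block k. (cmod (\<alpha> i))\<^sup>2)"
  unfolding rsigma_seq_square sum_distrib_left
  by (intro sum_mono mult_right_mono dyadic_block_bounds) auto

lemma card_dyadic_block_mult_sum_le:
  "real (card (dyadic_block k)) * (\<Sum>i\<in>dyadic_block k. (cmod (\<alpha> i))\<^sup>2) \<le> (rsigma_seq \<alpha> k)\<^sup>2"
  unfolding rsigma_seq_square sum_distrib_left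
  by (intro sum_mono mult_right_mono of_nat_mono card_dyadic_block_le) auto

lemma sum_inverse_sqrt_le: "(\<Sum>j\<le>i. 1 / sqrt (real (j+1))) \<le> 2 * sqrt (real (i+1))"
proof (induction i)
  case (Suc i)
  define a b where "a = sqrt (real (i+1))" and "b = sqrt (real (i+2))"
  have squares: "0 \<le> a" "0 < b" "b\<^sup>2 = a\<^sup>2 + 1"
    by (auto simp: a_def b_def)
  have "0 \<le> (b - a)\<^sup>2" by simp
  then have "1 \<le> 2 * (b - a) * b"
    using squares by (simp add: power2_eq_square algebra_simps)
  then have "1 / b \<le> 2 * (b - a)"
    using squares by (simp add: divide_le_eq)
  with Suc show ?case
    by (simp add: a_def b_def algebra_simps)
qed simp

text \<open>Cauchy--Schwarz with the weights \<open>(j + 1) powr (1/4)\<close>, the classical choice in Hardy's inequality.\<close>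

lemma norm_sum_square_le_weighted:
  fixes f :: "nat \<Rightarrow> 'a :: real_normed_vector"
  shows "(norm (\<Sum>j\<le>i. f j))\<^sup>2 \<le> 2 * sqrt (real (i+1)) * (\<Sum>j\<le>i. sqrt (real (j+1)) * (norm (f j))\<^sup>2)"
proof -
  define u where "u j = sqrt (sqrt (real (j+1)))" for j
  have weight: "0 < u j" "(u j)\<^sup>2 = sqrt (real (j+1))" for j
    by (auto simp: u_def)
  have "(norm (\<Sum>j\<le>i. f j))\<^sup>2 \<le> (\<Sum>j\<le>i. norm (f j))\<^sup>2"
    by (intro power_mono norm_sum) auto
  also have "(\<Sum>j\<le>i. norm (f j)) = (\<Sum>j\<le>i. (1 / u j) * (u j * norm (f j)))"
    using weight(1) by (intro sum.cong) (auto simp: less_imp_neq[symmetric])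
  also have "(\<dots>)\<^sup>2 \<le> (\<Sum>j\<le>i. (1 / u j)\<^sup>2) * (\<Sum>j\<le>i. (u j * norm (f j))\<^sup>2)"
    by (rule Cauchy_Schwarz_ineq_sum)
  also have "\<dots> = (\<Sum>j\<le>i. 1 / sqrt (real (j+1))) * (\<Sum>j\<le>i. sqrt (real (j+1)) * (norm (f j))\<^sup>2)"
    by (simp add: power_divide power_mult_distrib weight(2))
  also have "\<dots> \<le> 2 * sqrt (real (i+1)) * (\<Sum>j\<le>i. sqrt (real (j+1)) * (norm (f j))\<^sup>2)"
    by (intro mult_right_mono sum_inverse_sqrt_le sum_nonneg) auto
  finally show ?thesis .
qed

lemma sqrt_weighted_block_sum_le:
  fixes w :: "nat \<Rightarrow> real"
  assumes nonneg: "\<And>i. 0 \<le> w i" and block_sums: "(\<Sum>i\<in>dyadic_block k. real (i+1) * w i) \<le> B"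
  shows "(\<Sum>i\<in>dyadic_block k. sqrt (real (i+1)) * w i) \<le> sqrt 2 * B * (1 / sqrt 2)^k"
proof -
  have "sqrt (real (i+1)) * w i \<le> sqrt 2 * (1 / sqrt 2)^k * (real (i+1) * w i)"
    if "i \<in> dyadic_block k" for i
  proof -
    have "sqrt (2^k) \<le> sqrt (2 * real (i+1))"
      by (intro real_sqrt_le_mono dyadic_block_bounds(1) that)
    then have "sqrt 2 ^ k \<le> sqrt 2 * sqrt (real (i+1))"
      unfolding real_sqrt_mult real_sqrt_power .
    then have "1 \<le> sqrt 2 * (1 / sqrt 2)^k * sqrt (real (i+1))"
      by (simp add: power_one_over le_divide_eq)
    then have "1 * (sqrt (real (i+1)) * w i) \<le>
        sqrt 2 * (1 / sqrt 2)^k * sqrt (real (i+1)) * (sqrt (real (i+1)) * w i)"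
      by (rule mult_right_mono) (simp add: nonneg)
    also have "\<dots> = sqrt 2 * (1 / sqrt 2)^k * ((sqrt (real (i+1)))\<^sup>2 * w i)"
      by (simp only: power2_eq_square mult.assoc)
    finally show ?thesis
      by simp
  qed
  then have "(\<Sum>i\<in>dyadic_block k. sqrt (real (i+1)) * w i) \<le>
      sqrt 2 * (1 / sqrt 2)^k * (\<Sum>i\<in>dyadic_block k. real (i+1) * w i)"
    unfolding sum_distrib_left by (intro sum_mono)
  also have "\<dots> \<le> sqrt 2 * (1 / sqrt 2)^k * B"
    by (intro mult_left_mono block_sums) simp
  finally show ?thesis
    by (simp add: mult_ac)
qed

lemma sum_inverse_sqrt_2_power_le: "(\<Sum>k=K..L. (1 / sqrt 2)^k) \<le> 7/2 * (1 / sqrt (2^K))"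
proof -
  define r :: real where "r = 1 / sqrt 2"
  have "r = sqrt 2 / 2"
    using real_div_sqrt[of 2] by (simp add: r_def)
  moreover have "sqrt 2 \<le> 10/7"
    by (rule real_le_lsqrt) (simp_all add: power2_eq_square)
  ultimately have ratio: "0 < r" "r \<le> 5/7"
    by (simp_all add: r_def)
  have "(\<Sum>k=K..L. r^k) \<le> r^K / (1 - r)"
    using ratio by (simp add: sum_gp divide_right_mono)
  also have "\<dots> \<le> r^K / (2/7)"
    using ratio by (intro divide_left_mono) auto
  also have "\<dots> = 7/2 * (1 / sqrt (2^K))"
    by (simp add: r_def power_one_over real_sqrt_power)
  finally show ?thesis
    by (simp only: r_def)
qed

lemma sqrt_weighted_tail_sum_le:
  fixes w :: "nat \<Rightarrow> real"
  assumes nonneg: "\<And>i. 0 \<le> w i" and block_sums: "\<And>k. (\<Sum>i\<in>dyadic_block k. real (i+1) * w i) \<le> B"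
  shows "(\<Sum>i=j..<M. sqrt (real (i+1)) * w i) \<le> 5 * B / sqrt (real (j+1))"
proof -
  define K L where "K = floorlog 2 j" and "L = floorlog 2 M"
  have "0 \<le> B"
    using block_sums[of 0] nonneg[of 0] by (simp add: dyadic_block_0)
  have "{j..<M} \<subseteq> (\<Union>k\<in>{K..L}. dyadic_block k)"
    by (auto simp: in_dyadic_block_iff K_def L_def intro!: floorlog_mono)
  then have "(\<Sum>i=j..<M. sqrt (real (i+1)) * w i) \<le>
      (\<Sum>i\<in>(\<Union>k\<in>{K..L}. dyadic_block k). sqrt (real (i+1)) * w i)"
    by (intro sum_mono2) (auto simp: nonneg)
  also have "\<dots> = (\<Sum>k=K..L. \<Sum>i\<in>dyadic_block k. sqrt (real (i+1)) * w i)"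
    by (intro sum.UNION_disjoint) (auto simp: in_dyadic_block_iff)
  also have "\<dots> \<le> sqrt 2 * B * (\<Sum>k=K..L. (1 / sqrt 2)^k)"
    unfolding sum_distrib_left by (intro sum_mono sqrt_weighted_block_sum_le nonneg block_sums)
  also have "\<dots> \<le> sqrt 2 * B * (7/2 * (1 / sqrt (2^K)))"
    using \<open>0 \<le> B\<close> by (intro mult_left_mono sum_inverse_sqrt_2_power_le) simp
  also have "\<dots> \<le> 10/7 * B * (7/2 * (1 / sqrt (real (j+1))))"
  proof (intro mult_mono)
    show "sqrt 2 \<le> 10/7"
      by (rule real_le_lsqrt) (simp_all add: power2_eq_square)
    show "1 / sqrt (2^K) \<le> 1 / sqrt (real (j+1))"
      using dyadic_block_bounds(2)[of j K]
      by (intro divide_left_mono) (auto simp: in_dyadic_block_iff K_def)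
  qed (use \<open>0 \<le> B\<close> in auto)
  finally show ?thesis
    by simp
qed

lemma dyadic_hardy_inequality:
  fixes w :: "nat \<Rightarrow> real" and f :: "nat \<Rightarrow> 'a :: real_normed_vector"
  assumes nonneg: "\<And>i. 0 \<le> w i" and block_sums: "\<And>k. (\<Sum>i\<in>dyadic_block k. real (i+1) * w i) \<le> B"
  shows "(\<Sum>i<M. w i * (norm (\<Sum>j\<le>i. f j))\<^sup>2) \<le> 10 * B * (\<Sum>j<M. (norm (f j))\<^sup>2)"
proof -
  have "(\<Sum>i<M. w i * (norm (\<Sum>j\<le>i. f j))\<^sup>2) \<le>
      (\<Sum>i<M. w i * (2 * sqrt (real (i+1)) * (\<Sum>j\<le>i. sqrt (real (j+1)) * (norm (f j))\<^sup>2)))"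
    by (intro sum_mono mult_left_mono norm_sum_square_le_weighted nonneg)
  also have "\<dots> = (\<Sum>i<M. \<Sum>j\<le>i. 2 * sqrt (real (j+1)) * (norm (f j))\<^sup>2 * (sqrt (real (i+1)) * w i))"
    by (simp add: sum_distrib_left mult_ac)
  also have "\<dots> = (\<Sum>j<M. 2 * sqrt (real (j+1)) * (norm (f j))\<^sup>2 * (\<Sum>i=j..<M. sqrt (real (i+1)) * w i))"
    by (subst sum_triangle_swap) (simp add: sum_distrib_left)
  also have "\<dots> \<le> (\<Sum>j<M. 2 * sqrt (real (j+1)) * (norm (f j))\<^sup>2 * (5 * B / sqrt (real (j+1))))"
    by (intro sum_mono mult_left_mono sqrt_weighted_tail_sum_le[OF nonneg block_sums]) auto
  also have "\<dots> = 10 * B * (\<Sum>j<M. (norm (f j))\<^sup>2)"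
    by (simp add: sum_distrib_left field_simps)
  finally show ?thesis .
qed

lemma opnorm_rhaly_le:
  assumes "\<And>k. rsigma_seq \<alpha> k \<le> t"
  shows "opnorm (rhaly \<alpha>) \<le> ennreal (4 * t)"
proof (intro opnorm_leI l2nrm_le_mult_l2nrm)
  show "0 \<le> 4 * t"
    using assms[of 0] rsigma_seq_nonneg[of \<alpha> 0] by linarith
  fix f M
  have "(\<Sum>i<M. (cmod (rhaly \<alpha> f i))\<^sup>2) = (\<Sum>i<M. (cmod (\<alpha> i))\<^sup>2 * (cmod (\<Sum>j\<le>i. f j))\<^sup>2)"
    by (simp add: rhaly_def norm_mult power_mult_distrib)
  also have "\<dots> \<le> 10 * t\<^sup>2 * (\<Sum>j<M. (cmod (f j))\<^sup>2)"
  proof (rule dyadic_hardy_inequality)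
    show "(\<Sum>i\<in>dyadic_block k. real (i+1) * (cmod (\<alpha> i))\<^sup>2) \<le> t\<^sup>2" for k
      unfolding rsigma_seq_square[symmetric] by (intro power_mono assms rsigma_seq_nonneg)
  qed simp
  also have "\<dots> \<le> (4 * t)\<^sup>2 * (\<Sum>j<M. (cmod (f j))\<^sup>2)"
    by (intro mult_right_mono sum_nonneg) (auto simp: power_mult_distrib)
  finally show "(\<Sum>i<M. (cmod (rhaly \<alpha> f i))\<^sup>2) \<le> (4 * t)\<^sup>2 * (\<Sum>j<M. (cmod (f j))\<^sup>2)" .
qed

lemma rhaly_scale: "rhaly \<alpha> (\<lambda>k. c * f k) = (\<lambda>k. c * rhaly \<alpha> f k)"
  by (simp add: rhaly_def sum_distrib_left[symmetric] mult_ac)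

section \<open>Necessity\<close>

text \<open>The part of the test function on the later block makes its partial sums vanish beyond that
  block, so that the images under the Rhaly operator of well separated test functions do not interact.\<close>

definition dyadic_test :: "nat \<Rightarrow> nat \<Rightarrow> complex" where
  "dyadic_test m j = indicator (dyadic_block (m+1)) j - indicator (dyadic_block (m+3)) j / 4"

definition three_separated :: "nat set \<Rightarrow> bool" where
  "three_separated K \<longleftrightarrow> (\<forall>m\<in>K. \<forall>m'\<in>K. m < m' \<longrightarrow> m + 3 \<le> m')"

lemma three_separated_subset: "three_separated K \<Longrightarrow> L \<subseteq> K \<Longrightarrow> three_separated L"
  unfolding three_separated_def by blast

lemma three_separated_residue_class: "three_separated {m \<in> A. m mod 3 = r}"
proof -
  have "m + 3 \<le> m'" if "m < m'" "m mod 3 = m' mod 3" for m m' :: nat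
    using that by presburger
  then show ?thesis
    by (simp add: three_separated_def)
qed

lemma three_separatedD:
  assumes "three_separated K" "m \<in> K" "m' \<in> K" "m \<noteq> m'"
  shows "m + 3 \<le> m' \<or> m' + 3 \<le> m"
  using assms unfolding three_separated_def by (meson linorder_neqE_nat)

lemma sum_lessThan_norm_dyadic_test_square_le: "(\<Sum>j<M. (cmod (dyadic_test m j))\<^sup>2) \<le> 2^(m+1)"
proof -
  let ?A = "dyadic_block (m+1)" and ?B = "dyadic_block (m+3)"
  have card_bound: "(\<Sum>j<M. indicator A j :: real) \<le> card A" if "finite A" for A :: "nat set"
    using that by (simp add: sum.If_cases indicator_def card_mono)
  have "(cmod (dyadic_test m j))\<^sup>2 = indicator ?A j + indicator ?B j / 16" for j
    by (auto simp: dyadic_test_def in_dyadic_block_iff indicator_def power2_eq_square)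
  then have "(\<Sum>j<M. (cmod (dyadic_test m j))\<^sup>2) = (\<Sum>j<M. indicator ?A j) + (\<Sum>j<M. indicator ?B j) / 16"
    by (simp add: sum.distrib sum_divide_distrib)
  also have "\<dots> \<le> card ?A + card ?B / 16"
    by (intro add_mono divide_right_mono card_bound) auto
  also have "\<dots> \<le> 2^(m+1)"
    by (simp add: card_dyadic_block power_add)
  finally show ?thesis .
qed

lemma sum_atMost_indicator_dyadic_block:
  assumes "floorlog 2 i \<noteq> k"
  shows "(\<Sum>j\<le>i. indicator (dyadic_block k) j) =
    (if k < floorlog 2 i then of_nat (card (dyadic_block k)) else (0 :: 'a :: semiring_1))"
proof -
  have "dyadic_block k \<inter> {..i} = (if k < floorlog 2 i then dyadic_block k else {})"
  proof (cases "k < floorlog 2 i")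
    case True
    have "j \<le> i" if "floorlog 2 j = k" for j
      using True that floorlog_mono[of i j 2] by linarith
    with True show ?thesis
      by (auto simp: in_dyadic_block_iff)
  next
    case False
    have "floorlog 2 j \<noteq> k" if "j \<le> i" for j
      using False assms that floorlog_mono[of j i 2] by linarith
    with False show ?thesis
      by (auto simp: in_dyadic_block_iff)
  qed
  then show ?thesis
    by (simp add: indicator_def sum.If_cases Int_commute)
qed

lemma sum_atMost_dyadic_test_middle:
  assumes "i \<in> dyadic_block (m+2)"
  shows "(\<Sum>j\<le>i. dyadic_test m j) = 2^m"
  using assms
  by (simp add: dyadic_test_def sum_subtractf sum_divide_distrib[symmetric] in_dyadic_block_iff
      sum_atMost_indicator_dyadic_block card_dyadic_block)

lemma sum_atMost_dyadic_test_outside: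
  assumes "floorlog 2 i \<le> m \<or> m + 4 \<le> floorlog 2 i"
  shows "(\<Sum>j\<le>i. dyadic_test m j) = 0"
  using assms
  by (auto simp: dyadic_test_def sum_subtractf sum_divide_distrib[symmetric] power_add
      sum_atMost_indicator_dyadic_block card_dyadic_block)

lemma dyadic_test_l2: "dyadic_test m \<in> l2"
  by (rule l2_if_finite_support, rule finite_subset[of _ "dyadic_block (m+1) \<union> dyadic_block (m+3)"])
    (auto simp: dyadic_test_def indicator_def)

definition dyadic_combination :: "nat set \<Rightarrow> (nat \<Rightarrow> complex) \<Rightarrow> nat \<Rightarrow> complex" where
  "dyadic_combination K x j = (\<Sum>m\<in>K. x m * dyadic_test m j)"

lemma sum_atMost_dyadic_combination:
  assumes separated: "finite K" "three_separated K" "m \<in> K" and middle: "i \<in> dyadic_block (m+2)"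
  shows "(\<Sum>j\<le>i. dyadic_combination K x j) = x m * 2^m"
proof -
  have "(\<Sum>j\<le>i. dyadic_combination K x j) = (\<Sum>k\<in>K. x k * (\<Sum>j\<le>i. dyadic_test k j))"
    unfolding dyadic_combination_def sum_distrib_left by (rule sum.swap)
  also have "\<dots> = x m * (\<Sum>j\<le>i. dyadic_test m j) + (\<Sum>k\<in>K-{m}. x k * (\<Sum>j\<le>i. dyadic_test k j))"
    by (rule sum.remove[OF separated(1,3)])
  also have "(\<Sum>k\<in>K-{m}. x k * (\<Sum>j\<le>i. dyadic_test k j)) = 0"
  proof (rule sum.neutral, rule ballI)
    fix k assume "k \<in> K - {m}"
    then have "floorlog 2 i \<le> k \<or> k + 4 \<le> floorlog 2 i"
      using three_separatedD[OF separated(2,3), of k] middle by (auto simp: in_dyadic_block_iff)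
    then show "x k * (\<Sum>j\<le>i. dyadic_test k j) = 0"
      by (simp add: sum_atMost_dyadic_test_outside)
  qed
  finally show ?thesis
    by (simp add: sum_atMost_dyadic_test_middle[OF middle])
qed

lemma dyadic_combination_nonzero:
  assumes "finite K" "three_separated K" "m \<in> K" "x m \<noteq> 0"
  shows "dyadic_combination K x \<noteq> (\<lambda>_. 0)"
proof
  assume zero: "dyadic_combination K x = (\<lambda>_. 0)"
  have "2^(m+1) \<in> dyadic_block (m+2)"
    by (simp add: dyadic_block_Suc)
  from sum_atMost_dyadic_combination[OF assms(1-3) this, of x] assms(4) zero show False
    by simp
qed

lemma l2nrm_dyadic_combination_le:
  assumes "finite K" "three_separated K"
  shows "l2nrm (dyadic_combination K x) \<le> ennreal (sqrt (\<Sum>m\<in>K. (cmod (x m))\<^sup>2 * 2^(m+1)))"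
proof (rule l2nrm_leI)
  fix M
  have "(cmod (dyadic_combination K x j))\<^sup>2 = (\<Sum>m\<in>K. (cmod (x m))\<^sup>2 * (cmod (dyadic_test m j))\<^sup>2)" for j
  proof -
    have "x k * dyadic_test k j = 0 \<or> x l * dyadic_test l j = 0" if "k \<in> K" "l \<in> K" "k \<noteq> l" for k l
      using three_separatedD[OF assms(2) that]
      by (auto simp: dyadic_test_def indicator_def in_dyadic_block_iff)
    from norm_sum_square_disjoint[OF assms(1) this] show ?thesis
      by (simp add: dyadic_combination_def norm_mult power_mult_distrib)
  qed
  then have "(\<Sum>j<M. (cmod (dyadic_combination K x j))\<^sup>2) =
      (\<Sum>m\<in>K. (cmod (x m))\<^sup>2 * (\<Sum>j<M. (cmod (dyadic_test m j))\<^sup>2))"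
    unfolding sum_distrib_left by (simp add: sum.swap[of _ K])
  also have "\<dots> \<le> (\<Sum>m\<in>K. (cmod (x m))\<^sup>2 * 2^(m+1))"
    by (intro sum_mono mult_left_mono sum_lessThan_norm_dyadic_test_square_le) auto
  finally show "(\<Sum>j<M. (cmod (dyadic_combination K x j))\<^sup>2) \<le> (\<Sum>m\<in>K. (cmod (x m))\<^sup>2 * 2^(m+1))" .
qed

lemma sum_rhaly_dyadic_combination_ge:
  assumes separated: "finite K" "three_separated K" "m \<in> K" and lower: "0 \<le> s" "s \<le> rsigma_seq \<alpha> (m+2)"
  shows "(s/3)\<^sup>2 * ((cmod (x m))\<^sup>2 * 2^(m+1)) \<le>
    (\<Sum>i\<in>dyadic_block (m+2). (cmod (rhaly \<alpha> (dyadic_combination K x) i))\<^sup>2)"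
proof -
  define A where "A = (\<Sum>i\<in>dyadic_block (m+2). (cmod (\<alpha> i))\<^sup>2)"
  have "s\<^sup>2 \<le> (rsigma_seq \<alpha> (m+2))\<^sup>2"
    using lower by (intro power_mono)
  also have "\<dots> \<le> 2^(m+2) * A"
    unfolding A_def by (rule rsigma_seq_square_le)
  finally have "s\<^sup>2 * ((cmod (x m))\<^sup>2 * 2^m / 4) \<le> 2^(m+2) * A * ((cmod (x m))\<^sup>2 * 2^m / 4)"
    by (rule mult_right_mono) simp
  moreover have "(s/3)\<^sup>2 * ((cmod (x m))\<^sup>2 * 2^(m+1)) \<le> s\<^sup>2 * ((cmod (x m))\<^sup>2 * 2^m / 4)"
    by (simp add: power_divide)
  moreover have "(\<Sum>i\<in>dyadic_block (m+2). (cmod (rhaly \<alpha> (dyadic_combination K x) i))\<^sup>2) =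
      A * (cmod (x m) * 2^m)\<^sup>2"
    by (simp add: rhaly_def sum_atMost_dyadic_combination[OF separated] A_def sum_distrib_right
        norm_mult norm_power power_mult_distrib)
  ultimately show ?thesis
    by (simp add: power_mult_distrib power2_eq_square[of "2^m"] mult_ac)
qed

lemma l2nrm_rhaly_dyadic_combination_ge:
  assumes separated: "finite K" "three_separated K" and lower: "0 \<le> s" "\<And>m. m \<in> K \<Longrightarrow> s \<le> rsigma_seq \<alpha> (m+2)"
  shows "ennreal (s/3) * l2nrm (dyadic_combination K x) \<le> l2nrm (rhaly \<alpha> (dyadic_combination K x))"
proof -
  define W where "W = (\<Sum>m\<in>K. (cmod (x m))\<^sup>2 * 2^(m+1))"
  let ?g = "\<lambda>i. cmod (rhaly \<alpha> (dyadic_combination K x) i)" and ?I = "\<Union>m\<in>K. dyadic_block (m+2)"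
  have "(s/3)\<^sup>2 * W \<le> (\<Sum>m\<in>K. \<Sum>i\<in>dyadic_block (m+2). (?g i)\<^sup>2)"
    unfolding W_def sum_distrib_left by (intro sum_mono sum_rhaly_dyadic_combination_ge separated lower)
  also have "\<dots> = (\<Sum>i\<in>?I. (?g i)\<^sup>2)"
    using separated(1) by (intro sum.UNION_disjoint[symmetric]) (auto simp: in_dyadic_block_iff)
  finally have "sqrt ((s/3)\<^sup>2 * W) \<le> L2_set ?g ?I"
    unfolding L2_set_def by (rule real_sqrt_le_mono)
  have "ennreal (s/3) * l2nrm (dyadic_combination K x) \<le> ennreal (s/3) * ennreal (sqrt W)"
    unfolding W_def by (intro mult_left_mono l2nrm_dyadic_combination_le separated) simp
  also have "\<dots> = ennreal (sqrt ((s/3)\<^sup>2 * W))"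
    using lower(1) by (simp add: ennreal_mult[symmetric] real_sqrt_mult W_def sum_nonneg)
  also have "\<dots> \<le> ennreal (L2_set ?g ?I)"
    by (intro ennreal_leI) fact
  also have "\<dots> \<le> l2nrm (rhaly \<alpha> (dyadic_combination K x))"
    using separated(1) by (intro L2_set_le_l2nrm) simp
  finally show ?thesis .
qed

lemma approx_num_rhaly_ge:
  assumes separated: "finite K" "n < card K" "three_separated K"
    and lower: "0 \<le> s" "\<And>m. m \<in> K \<Longrightarrow> s \<le> rsigma_seq \<alpha> (m+2)"
  shows "ennreal (s/3) \<le> approx_num (rhaly \<alpha>) n"
proof (rule approx_num_ge_if_bounded_below[OF rhaly_scale separated(1,2) dyadic_test_l2])
  show "(\<lambda>j. \<Sum>m\<in>K. x m * dyadic_test m j) \<noteq> (\<lambda>_. 0)" if "\<exists>m\<in>K. x m \<noteq> 0" for x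
    using that dyadic_combination_nonzero[OF separated(1,3)] unfolding dyadic_combination_def by blast
  show "ennreal (s/3) * l2nrm (\<lambda>j. \<Sum>m\<in>K. x m * dyadic_test m j)
      \<le> l2nrm (rhaly \<alpha> (\<lambda>j. \<Sum>m\<in>K. x m * dyadic_test m j))" for x
    using l2nrm_rhaly_dyadic_combination_ge[OF separated(1,3) lower] unfolding dyadic_combination_def .
qed

lemma sum_rsigma_seq_powr_le:
  assumes finite_approx: "\<And>n. approx_num (rhaly \<alpha>) n < \<infinity>" and "0 < q"
    and separated: "finite F" "three_separated F"
  shows "(\<Sum>m\<in>F. rsigma_seq \<alpha> (m+2) powr q) \<le>
    (\<Sum>n<card F. 3 powr q * enn2real (approx_num (rhaly \<alpha>) n) powr q)"
proof (rule sum_le_sum_lessThan_card[OF separated(1)])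
  fix G assume subset: "G \<subseteq> F" "G \<noteq> {}"
  let ?h = "\<lambda>m. rsigma_seq \<alpha> (m+2)" and ?a = "enn2real (approx_num (rhaly \<alpha>) (card G - 1))"
  have "finite G"
    using subset(1) separated(1) by (rule finite_subset)
  then obtain m where smallest: "m \<in> G" "\<And>k. k \<in> G \<Longrightarrow> ?h m \<le> ?h k"
    using subset(2) ex_min_if_finite[of "?h ` G"] by (auto simp: not_less)
  have "card G - 1 < card G"
    using \<open>finite G\<close> subset(2) by (simp add: card_gt_0_iff)
  then have "ennreal (?h m / 3) \<le> approx_num (rhaly \<alpha>) (card G - 1)"
    using smallest \<open>finite G\<close> three_separated_subset[OF separated(2) subset(1)]
    by (intro approx_num_rhaly_ge[of G]) (auto simp: rsigma_seq_nonneg)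
  then have "enn2real (ennreal (?h m / 3)) \<le> ?a"
    using finite_approx by (intro enn2real_mono) auto
  then have "?h m \<le> 3 * ?a"
    by (simp add: rsigma_seq_nonneg)
  then have "?h m powr q \<le> (3 * ?a) powr q"
    using \<open>0 < q\<close> by (intro powr_mono2) (auto simp: rsigma_seq_nonneg)
  then have "?h m powr q \<le> 3 powr q * ?a powr q"
    by (simp add: powr_mult)
  with smallest(1) show "\<exists>m\<in>G. ?h m powr q \<le> 3 powr q * ?a powr q" ..
qed

lemma summable_rsigma_seq_if_schatten:
  assumes "schatten q (rhaly \<alpha>)" "0 < q"
  shows "summable (\<lambda>k. rsigma_seq \<alpha> k powr q)"
proof -
  define a where "a n = 3 powr q * enn2real (approx_num (rhaly \<alpha>) n) powr q" for n
  have finite_approx: "approx_num (rhaly \<alpha>) n < \<infinity>" for n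
    using assms by (simp add: schatten_def)
  have "summable a"
    unfolding a_def by (rule summable_mult) (use assms in \<open>simp add: schatten_def\<close>)
  have "summable (\<lambda>m. rsigma_seq \<alpha> (m+2) powr q)"
  proof (rule summableI_nonneg_bounded)
    fix M
    let ?F = "\<lambda>r :: nat. {m \<in> {..<M}. m mod 3 = r}"
    have "(\<Sum>m<M. rsigma_seq \<alpha> (m+2) powr q) = (\<Sum>r<3. \<Sum>m\<in>?F r. rsigma_seq \<alpha> (m+2) powr q)"
      by (rule sum.group[symmetric]) auto
    also have "\<dots> \<le> (\<Sum>r<(3::nat). suminf a)"
    proof (rule sum_mono)
      fix r
      have "(\<Sum>m\<in>?F r. rsigma_seq \<alpha> (m+2) powr q) \<le> sum a {..<card (?F r)}"
        unfolding a_def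
        by (intro sum_rsigma_seq_powr_le finite_approx assms(2) three_separated_residue_class) simp
      also have "\<dots> \<le> suminf a"
        by (intro sum_le_suminf \<open>summable a\<close>) (auto simp: a_def)
      finally show "(\<Sum>m\<in>?F r. rsigma_seq \<alpha> (m+2) powr q) \<le> suminf a" .
    qed
    finally show "(\<Sum>m<M. rsigma_seq \<alpha> (m+2) powr q) \<le> (\<Sum>r<(3::nat). suminf a)" .
  qed simp
  then show ?thesis
    by (subst (asm) summable_iff_shift)
qed

section \<open>Coarsening the partial sums\<close>

lemma sum_weighted_gaps_le:
  fixes w :: "nat \<Rightarrow> real" and p :: "nat \<Rightarrow> nat"
  assumes nonneg: "\<And>i. 0 \<le> w i"
    and start_constant: "\<And>i j. p i < j \<Longrightarrow> j \<le> i \<Longrightarrow> p j = p i"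
    and mass: "\<And>i. real (i - p i) * (\<Sum>l\<in>{p i<..i}. w l) \<le> B"
  shows "(\<Sum>i | i < M \<and> p i < j \<and> j \<le> i. w i * real (i - p i)) \<le> B"
proof (cases "{i. i < M \<and> p i < j \<and> j \<le> i} = {}")
  case True
  have "0 \<le> real (0 - p 0) * (\<Sum>l\<in>{p 0<..0}. w l)"
    by simp
  also have "\<dots> \<le> B"
    by (rule mass)
  finally show ?thesis
    unfolding True by simp
next
  case False
  define I where "I = {i. i < M \<and> p i < j \<and> j \<le> i}"
  define m where "m = Max I"
  have "finite I"
    by (simp add: I_def)
  then have last: "m \<in> I" "\<And>i. i \<in> I \<Longrightarrow> i \<le> m"
    using False by (auto simp: m_def I_def[symmetric])
  have start: "p i = p m" if "i \<in> I" for i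
    using start_constant[of i j] start_constant[of m j] that last(1) by (simp add: I_def)
  have subset: "I \<subseteq> {p m<..m}"
    using start last(2) by (auto simp: I_def)
  have "(\<Sum>i\<in>I. w i * real (i - p i)) \<le> (\<Sum>i\<in>I. w i * real (m - p m))"
    using last(2) by (intro sum_mono mult_left_mono nonneg) (simp add: start diff_le_mono)
  also have "\<dots> = real (m - p m) * (\<Sum>i\<in>I. w i)"
    by (simp add: sum_distrib_right[symmetric])
  also have "\<dots> \<le> real (m - p m) * (\<Sum>i\<in>{p m<..m}. w i)"
    by (intro mult_left_mono sum_mono2 subset nonneg) auto
  also have "\<dots> \<le> B"
    by (rule mass)
  finally show ?thesis
    by (simp add: I_def)
qed

lemma piecewise_sum_inequality:
  fixes w :: "nat \<Rightarrow> real" and f :: "nat \<Rightarrow> 'a :: real_normed_vector" and p :: "nat \<Rightarrow> nat"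
  assumes nonneg: "\<And>i. 0 \<le> w i"
    and start_constant: "\<And>i j. p i < j \<Longrightarrow> j \<le> i \<Longrightarrow> p j = p i"
    and mass: "\<And>i. real (i - p i) * (\<Sum>l\<in>{p i<..i}. w l) \<le> B"
  shows "(\<Sum>i<M. w i * (norm (\<Sum>j\<in>{p i<..i}. f j))\<^sup>2) \<le> B * (\<Sum>j<M. (norm (f j))\<^sup>2)"
proof -
  have cauchy_schwarz: "(norm (\<Sum>j\<in>{p i<..i}. f j))\<^sup>2 \<le> (\<Sum>j\<in>{p i<..i}. (norm (f j))\<^sup>2) * real (i - p i)" for i
  proof -
    have "(norm (\<Sum>j\<in>{p i<..i}. f j))\<^sup>2 \<le> (\<Sum>j\<in>{p i<..i}. norm (f j))\<^sup>2"
      by (intro power_mono norm_sum) auto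
    also have "\<dots> \<le> (\<Sum>j\<in>{p i<..i}. (norm (f j))\<^sup>2) * real (i - p i)"
      using sum_squared_le_sum_of_squares[of "\<lambda>j. norm (f j)" "{p i<..i}"] by simp
    finally show ?thesis .
  qed
  have "(\<Sum>i<M. w i * (norm (\<Sum>j\<in>{p i<..i}. f j))\<^sup>2) \<le>
      (\<Sum>i<M. w i * ((\<Sum>j\<in>{p i<..i}. (norm (f j))\<^sup>2) * real (i - p i)))"
    by (intro sum_mono mult_left_mono nonneg cauchy_schwarz)
  also have "\<dots> = (\<Sum>i<M. \<Sum>j\<in>{j \<in> {..<M}. p i < j \<and> j \<le> i}. (norm (f j))\<^sup>2 * (w i * real (i - p i)))"
  proof (intro sum.cong refl)
    fix i assume "i \<in> {..<M}"
    then have "{j \<in> {..<M}. p i < j \<and> j \<le> i} = {p i<..i}" by auto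
    then show "w i * ((\<Sum>j\<in>{p i<..i}. (norm (f j))\<^sup>2) * real (i - p i)) =
        (\<Sum>j\<in>{j \<in> {..<M}. p i < j \<and> j \<le> i}. (norm (f j))\<^sup>2 * (w i * real (i - p i)))"
      by (simp add: sum_distrib_left sum_distrib_right mult_ac)
  qed
  also have "\<dots> = (\<Sum>j<M. \<Sum>i\<in>{i \<in> {..<M}. p i < j \<and> j \<le> i}. (norm (f j))\<^sup>2 * (w i * real (i - p i)))"
    by (rule sum.swap_restrict) auto
  also have "\<dots> = (\<Sum>j<M. (norm (f j))\<^sup>2 * (\<Sum>i | i < M \<and> p i < j \<and> j \<le> i. w i * real (i - p i)))"
    by (simp add: sum_distrib_left)
  also have "\<dots> \<le> (\<Sum>j<M. (norm (f j))\<^sup>2 * B)"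
    by (intro sum_mono mult_left_mono sum_weighted_gaps_le nonneg start_constant mass) auto
  finally show ?thesis
    by (simp add: sum_distrib_left mult_ac)
qed

lemma cmod_sum_atMost_le_l2nrm: "ennreal (cmod (\<Sum>j\<le>m. f j)) \<le> ennreal (real (m+1)) * l2nrm f"
proof -
  have "ennreal (cmod (\<Sum>j\<le>m. f j)) \<le> ennreal (\<Sum>j\<le>m. cmod (f j))"
    by (intro ennreal_leI norm_sum)
  also have "\<dots> = (\<Sum>j\<le>m. ennreal (cmod (f j)))"
    by (simp add: sum_ennreal)
  also have "\<dots> \<le> (\<Sum>j\<le>m. l2nrm f)"
    by (intro sum_mono cmod_le_l2nrm)
  finally show ?thesis
    by (simp add: ennreal_of_nat_eq_real_of_nat)
qed

lemma finite_rank_le_partial_sums: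
  fixes \<alpha> :: "nat \<Rightarrow> complex" and L :: "nat \<Rightarrow> 'b" and e :: "'b \<Rightarrow> nat"
  assumes support: "finite {i. \<alpha> i \<noteq> 0}" and rank: "card (L ` {i. \<alpha> i \<noteq> 0}) \<le> n"
  shows "finite_rank_le n (\<lambda>f i. \<alpha> i * (\<Sum>j\<le>e (L i). f j))"
proof -
  let ?R = "L ` {i. \<alpha> i \<noteq> 0}" and ?v = "\<lambda>r i. if L i = r then \<alpha> i else 0"
  have "finite_rank_le n (\<lambda>f i. \<Sum>r\<in>?R. (\<Sum>j\<le>e r. f j) * ?v r i)"
  proof (rule finite_rank_leI[OF _ rank])
    show "?v r \<in> l2" for r
      by (rule l2_if_finite_support, rule finite_subset[OF _ support]) auto
    show "ennreal (cmod (\<Sum>j\<le>e r. f j)) \<le> ennreal (real (e r + 1)) * l2nrm f" for r f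
      by (rule cmod_sum_atMost_le_l2nrm)
  qed (simp_all add: support sum.distrib sum_distrib_left)
  moreover have "(\<Sum>r\<in>?R. (\<Sum>j\<le>e r. f j) * ?v r i) = \<alpha> i * (\<Sum>j\<le>e (L i). f j)" for f i
  proof (cases "\<alpha> i = 0")
    case False
    have "(\<Sum>r\<in>?R. (\<Sum>j\<le>e r. f j) * ?v r i) = (\<Sum>r\<in>?R. if L i = r then \<alpha> i * (\<Sum>j\<le>e r. f j) else 0)"
      by (intro sum.cong) auto
    with False support show ?thesis
      by (simp add: sum.delta')
  qed (simp cong: if_cong)
  ultimately show ?thesis
    by simp
qed

lemma rhaly_diff_partial_sum:
  assumes "m \<le> i"
  shows "rhaly \<alpha> f i - \<alpha> i * (\<Sum>j\<le>m. f j) = \<alpha> i * (\<Sum>j\<in>{m<..i}. f j)"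
proof -
  have "{..i} = {..m} \<union> {m<..i}"
    using assms by auto
  then have "(\<Sum>j\<le>i. f j) = (\<Sum>j\<le>m. f j) + (\<Sum>j\<in>{m<..i}. f j)"
    by (simp add: sum.union_disjoint disjoint_iff)
  then show ?thesis
    by (simp add: rhaly_def algebra_simps)
qed

text \<open>Replacing each partial sum by the one up to the start of its label class leaves one dimension
  per label.\<close>

lemma approx_num_rhaly_le_labelled:
  fixes L :: "nat \<Rightarrow> 'b"
  assumes t_nonneg: "0 \<le> t"
    and support: "finite {i. \<alpha> i \<noteq> 0}" and rank: "card (L ` {i. \<alpha> i \<noteq> 0}) \<le> n"
    and convex: "\<And>i j l. i \<le> j \<Longrightarrow> j \<le> l \<Longrightarrow> L i = L l \<Longrightarrow> L j = L l"
    and mass: "\<And>i j. i \<le> j \<Longrightarrow> L i = L j \<Longrightarrow> real (j - i) * (\<Sum>l\<in>{i<..j}. (cmod (\<alpha> l))\<^sup>2) \<le> t\<^sup>2"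
  shows "approx_num (rhaly \<alpha>) n \<le> ennreal t"
proof -
  define start where "start r = (LEAST j. L j = r)" for r
  have start_le: "start (L i) \<le> i" for i
    by (simp add: start_def Least_le)
  have L_start: "L (start (L i)) = L i" for i
    unfolding start_def by (rule LeastI[of _ i]) simp
  let ?P = "\<lambda>f i. \<alpha> i * (\<Sum>j\<le>start (L i). f j)"
  have "approx_num (rhaly \<alpha>) n \<le> opnorm (\<lambda>f i. rhaly \<alpha> f i - ?P f i)"
    by (intro approx_num_le finite_rank_le_partial_sums support rank)
  also have "\<dots> \<le> ennreal t"
  proof (intro opnorm_leI l2nrm_le_mult_l2nrm t_nonneg)
    fix f M
    have "(\<Sum>i<M. (cmod (rhaly \<alpha> f i - ?P f i))\<^sup>2) =
        (\<Sum>i<M. (cmod (\<alpha> i))\<^sup>2 * (cmod (\<Sum>j\<in>{start (L i)<..i}. f j))\<^sup>2)"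
      by (simp add: rhaly_diff_partial_sum start_le norm_mult power_mult_distrib)
    also have "\<dots> \<le> t\<^sup>2 * (\<Sum>j<M. (cmod (f j))\<^sup>2)"
    proof (rule piecewise_sum_inequality)
      show "start (L j) = start (L i)" if "start (L i) < j" "j \<le> i" for i j
        using convex[of "start (L i)" j i] L_start that by simp
      show "real (i - start (L i)) * (\<Sum>l\<in>{start (L i)<..i}. (cmod (\<alpha> l))\<^sup>2) \<le> t\<^sup>2" for i
        by (intro mass start_le L_start)
    qed simp
    finally show "(\<Sum>i<M. (cmod (rhaly \<alpha> f i - ?P f i))\<^sup>2) \<le> t\<^sup>2 * (\<Sum>j<M. (cmod (f j))\<^sup>2)" .
  qed
  finally show ?thesis .
qed

section \<open>Labels cutting the dyadic blocks into light intervals\<close>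

text \<open>Length and weight each charge a block at most \<open>\<sigma> / t\<close>, scaled so that \<open>length * weight \<le> t\<^sup>2\<close> on every
  interval of charge less than 1. A block with \<open>\<sigma> = 0\<close> has charge 0 since \<open>x / 0 = 0\<close>.\<close>

definition block_charge :: "(nat \<Rightarrow> complex) \<Rightarrow> real \<Rightarrow> nat \<Rightarrow> real" where
  "block_charge \<alpha> t l =
    (let k = floorlog 2 l; N = real (card (dyadic_block k)); s = rsigma_seq \<alpha> k
     in s / (t * N) + N * (cmod (\<alpha> l))\<^sup>2 / (s * t))"

definition cumulative_charge :: "(nat \<Rightarrow> complex) \<Rightarrow> real \<Rightarrow> nat \<Rightarrow> real" where
  "cumulative_charge \<alpha> t i = (\<Sum>l\<in>dyadic_block (floorlog 2 i) \<inter> {..i}. block_charge \<alpha> t l)"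

definition block_label :: "(nat \<Rightarrow> complex) \<Rightarrow> real \<Rightarrow> nat \<Rightarrow> nat \<times> nat" where
  "block_label \<alpha> t i = (floorlog 2 i, nat \<lfloor>cumulative_charge \<alpha> t i\<rfloor>)"

lemma block_charge_nonneg: "0 < t \<Longrightarrow> 0 \<le> block_charge \<alpha> t l"
  by (simp add: block_charge_def Let_def rsigma_seq_nonneg)

lemma cumulative_charge_nonneg: "0 < t \<Longrightarrow> 0 \<le> cumulative_charge \<alpha> t i"
  unfolding cumulative_charge_def by (intro sum_nonneg block_charge_nonneg)

lemma sum_block_charge:
  assumes "X \<subseteq> dyadic_block k"
  shows "(\<Sum>l\<in>X. block_charge \<alpha> t l) =
    real (card X) * (rsigma_seq \<alpha> k / (t * real (card (dyadic_block k)))) +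
    real (card (dyadic_block k)) * (\<Sum>l\<in>X. (cmod (\<alpha> l))\<^sup>2) / (rsigma_seq \<alpha> k * t)"
proof -
  have "floorlog 2 l = k" if "l \<in> X" for l
    using assms that by (auto simp: in_dyadic_block_iff)
  then have "(\<Sum>l\<in>X. block_charge \<alpha> t l) =
      (\<Sum>l\<in>X. rsigma_seq \<alpha> k / (t * real (card (dyadic_block k))) +
        real (card (dyadic_block k)) * (cmod (\<alpha> l))\<^sup>2 / (rsigma_seq \<alpha> k * t))"
    by (intro sum.cong) (simp_all add: block_charge_def Let_def)
  then show ?thesis
    by (simp add: sum.distrib sum_distrib_left sum_divide_distrib)
qed

lemma cumulative_charge_le:
  assumes "0 < t"
  shows "cumulative_charge \<alpha> t i \<le> 2 * rsigma_seq \<alpha> (floorlog 2 i) / t"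
proof -
  define k s N where "k = floorlog 2 i" and "s = rsigma_seq \<alpha> k" and "N = real (card (dyadic_block k))"
  have "i \<in> dyadic_block k"
    by (simp add: k_def in_dyadic_block_iff)
  then have "0 < N"
    by (auto simp: N_def card_gt_0_iff)
  have "cumulative_charge \<alpha> t i \<le> (\<Sum>l\<in>dyadic_block k. block_charge \<alpha> t l)"
    unfolding cumulative_charge_def k_def
    using \<open>0 < t\<close> by (intro sum_mono2) (auto simp: block_charge_nonneg)
  also have "\<dots> = s / t + N * (\<Sum>l\<in>dyadic_block k. (cmod (\<alpha> l))\<^sup>2) / (s * t)"
    using \<open>0 < N\<close> by (auto simp: sum_block_charge[OF subset_refl] s_def N_def)
  also have "\<dots> \<le> s / t + s\<^sup>2 / (s * t)"
    unfolding N_def s_def using \<open>0 < t\<close>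
    by (intro add_left_mono divide_right_mono card_dyadic_block_mult_sum_le) (simp add: rsigma_seq_nonneg)
  also have "\<dots> = 2 * s / t"
    by (simp add: power2_eq_square)
  finally show ?thesis
    by (simp add: s_def k_def)
qed

lemma block_label_index_le:
  assumes "0 < t" "t \<le> rsigma_seq \<alpha> (floorlog 2 i)"
  shows "t \<le> 3 * rsigma_seq \<alpha> (floorlog 2 i) / real (snd (block_label \<alpha> t i) + 1)"
proof -
  have "real (snd (block_label \<alpha> t i)) \<le> 2 * rsigma_seq \<alpha> (floorlog 2 i) / t"
    using cumulative_charge_nonneg[OF assms(1), of \<alpha> i] cumulative_charge_le[OF assms(1), of \<alpha> i]
    by (simp add: block_label_def) linarith
  then have "t * real (snd (block_label \<alpha> t i)) \<le> 2 * rsigma_seq \<alpha> (floorlog 2 i)"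
    using assms(1) by (simp add: field_simps)
  then show ?thesis
    using assms by (simp add: field_simps)
qed

lemma cumulative_charge_split:
  assumes "i \<le> j" "floorlog 2 i = floorlog 2 j"
  shows "cumulative_charge \<alpha> t j = cumulative_charge \<alpha> t i + (\<Sum>l\<in>{i<..j}. block_charge \<alpha> t l)"
proof -
  have "dyadic_block (floorlog 2 j) \<inter> {..j} = (dyadic_block (floorlog 2 i) \<inter> {..i}) \<union> {i<..j}"
    using assms greaterThanAtMost_subset_dyadic_block[OF assms(2)] by auto
  moreover have "(dyadic_block (floorlog 2 i) \<inter> {..i}) \<inter> {i<..j} = {}"
    by auto
  ultimately show ?thesis
    by (simp add: cumulative_charge_def sum.union_disjoint)
qed

lemma block_label_convex:
  assumes "0 < t" "i \<le> j" "j \<le> l" and same_label: "block_label \<alpha> t i = block_label \<alpha> t l"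
  shows "block_label \<alpha> t j = block_label \<alpha> t l"
proof -
  have same_block: "floorlog 2 i = floorlog 2 l"
    using same_label by (simp add: block_label_def)
  then have middle_block: "floorlog 2 j = floorlog 2 l"
    using floorlog_mono[OF \<open>i \<le> j\<close>, of 2] floorlog_mono[OF \<open>j \<le> l\<close>, of 2] by simp
  have mono: "cumulative_charge \<alpha> t a \<le> cumulative_charge \<alpha> t b" if "a \<le> b" "floorlog 2 a = floorlog 2 b" for a b
    using cumulative_charge_split[OF that, of \<alpha> t] \<open>0 < t\<close> by (simp add: sum_nonneg block_charge_nonneg)
  have "nat \<lfloor>cumulative_charge \<alpha> t i\<rfloor> \<le> nat \<lfloor>cumulative_charge \<alpha> t j\<rfloor>"
    "nat \<lfloor>cumulative_charge \<alpha> t j\<rfloor> \<le> nat \<lfloor>cumulative_charge \<alpha> t l\<rfloor>"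
    using same_block middle_block assms(2,3) by (auto intro!: nat_mono floor_mono mono)
  with same_label middle_block show ?thesis
    by (simp add: block_label_def)
qed

lemma block_label_mass_le:
  assumes "0 < t" "i \<le> j" and same_label: "block_label \<alpha> t i = block_label \<alpha> t j"
    and sigma_pos: "0 < rsigma_seq \<alpha> (floorlog 2 j)"
  shows "real (j - i) * (\<Sum>l\<in>{i<..j}. (cmod (\<alpha> l))\<^sup>2) \<le> t\<^sup>2"
proof -
  define k where "k = floorlog 2 j"
  define s N W where "s = rsigma_seq \<alpha> k" and "N = real (card (dyadic_block k))"
    and "W = (\<Sum>l\<in>{i<..j}. (cmod (\<alpha> l))\<^sup>2)"
  have same_block: "floorlog 2 i = floorlog 2 j"
    using same_label by (simp add: block_label_def)
  have pos: "0 < N" "0 < s" "0 \<le> W"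
    using sigma_pos by (auto simp: N_def s_def k_def W_def card_gt_0_iff in_dyadic_block_iff intro!: sum_nonneg)
  have "\<lfloor>cumulative_charge \<alpha> t i\<rfloor> = \<lfloor>cumulative_charge \<alpha> t j\<rfloor>"
    using same_label cumulative_charge_nonneg[OF \<open>0 < t\<close>] by (simp add: block_label_def eq_nat_nat_iff)
  then have "(\<Sum>l\<in>{i<..j}. block_charge \<alpha> t l) < 1"
    using cumulative_charge_split[OF \<open>i \<le> j\<close> same_block, of \<alpha> t] by linarith
  then have "real (j - i) * (s / (t * N)) + N * W / (s * t) < 1"
    using sum_block_charge[OF greaterThanAtMost_subset_dyadic_block[OF same_block], of \<alpha> t]
    by (simp add: s_def N_def W_def k_def)
  moreover have "0 \<le> real (j - i) * (s / (t * N))" "0 \<le> N * W / (s * t)"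
    using pos \<open>0 < t\<close> by simp_all
  ultimately have "(real (j - i) * (s / (t * N))) * (N * W / (s * t)) \<le> 1"
    by (intro mult_le_one[of "real (j - i) * (s / (t * N))"]) linarith+
  also have "(real (j - i) * (s / (t * N))) * (N * W / (s * t)) = real (j - i) * W / t\<^sup>2"
    using pos by (simp add: power2_eq_square)
  finally show ?thesis
    using \<open>0 < t\<close> by (simp add: W_def divide_le_eq)
qed

section \<open>Sufficiency\<close>

definition restrict_blocks :: "(nat \<Rightarrow> bool) \<Rightarrow> (nat \<Rightarrow> complex) \<Rightarrow> nat \<Rightarrow> complex" where
  "restrict_blocks Q \<alpha> i = (if Q (floorlog 2 i) then \<alpha> i else 0)"

lemma rsigma_seq_restrict_blocks: "rsigma_seq (restrict_blocks Q \<alpha>) k = (if Q k then rsigma_seq \<alpha> k else 0)"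
proof -
  have "(rsigma_seq (restrict_blocks Q \<alpha>) k)\<^sup>2 = (if Q k then rsigma_seq \<alpha> k else 0)\<^sup>2"
    by (auto simp: rsigma_seq_square restrict_blocks_def in_dyadic_block_iff)
  then show ?thesis
    by (rule power2_eq_imp_eq) (simp_all add: rsigma_seq_nonneg)
qed

lemma rhaly_restrict_blocks_add:
  "rhaly \<alpha> f i = rhaly (restrict_blocks (\<lambda>k. \<not> Q k) \<alpha>) f i + rhaly (restrict_blocks Q \<alpha>) f i"
  by (simp add: rhaly_def restrict_blocks_def)

definition rsigma_array :: "(nat \<Rightarrow> complex) \<Rightarrow> nat \<times> nat \<Rightarrow> real" where
  "rsigma_array \<alpha> = (\<lambda>(k, m). 3 * rsigma_seq \<alpha> k / real (m+1))"

lemma block_label_mass_restrict_le: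
  assumes "0 < t" "i \<le> j" and same_label: "block_label \<alpha> t i = block_label \<alpha> t j"
  shows "real (j - i) *
    (\<Sum>l\<in>{i<..j}. (cmod (restrict_blocks (\<lambda>k. t \<le> rsigma_seq \<alpha> k) \<alpha> l))\<^sup>2) \<le> t\<^sup>2"
proof (cases "t \<le> rsigma_seq \<alpha> (floorlog 2 j)")
  case True
  have "real (j - i) * (\<Sum>l\<in>{i<..j}. (cmod (restrict_blocks (\<lambda>k. t \<le> rsigma_seq \<alpha> k) \<alpha> l))\<^sup>2) \<le>
      real (j - i) * (\<Sum>l\<in>{i<..j}. (cmod (\<alpha> l))\<^sup>2)"
    by (intro mult_left_mono sum_mono) (simp_all add: restrict_blocks_def)
  also have "\<dots> \<le> t\<^sup>2"
    using True assms by (intro block_label_mass_le) auto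
  finally show ?thesis .
next
  case False
  have "{i<..j} \<subseteq> dyadic_block (floorlog 2 j)"
    using same_label by (intro greaterThanAtMost_subset_dyadic_block) (simp add: block_label_def)
  then have "restrict_blocks (\<lambda>k. t \<le> rsigma_seq \<alpha> k) \<alpha> l = 0" if "l \<in> {i<..j}" for l
    using False that by (auto simp: restrict_blocks_def in_dyadic_block_iff)
  then show ?thesis
    by simp
qed

lemma approx_num_rhaly_large_blocks_le:
  assumes t_pos: "0 < t" and cardinality: "finite F" "card F \<le> n" and cover: "\<And>x. t \<le> rsigma_array \<alpha> x \<Longrightarrow> x \<in> F"
  shows "approx_num (rhaly (restrict_blocks (\<lambda>k. t \<le> rsigma_seq \<alpha> k) \<alpha>)) n \<le> ennreal t"
proof -
  define \<beta> where "\<beta> = restrict_blocks (\<lambda>k. t \<le> rsigma_seq \<alpha> k) \<alpha>"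
  have nonzero: "t \<le> rsigma_seq \<alpha> (floorlog 2 i)" if "\<beta> i \<noteq> 0" for i
    using that by (auto simp: \<beta>_def restrict_blocks_def split: if_splits)
  have labels: "block_label \<alpha> t ` {i. \<beta> i \<noteq> 0} \<subseteq> F"
  proof (rule image_subsetI)
    fix i assume "i \<in> {i. \<beta> i \<noteq> 0}"
    then have "t \<le> rsigma_array \<alpha> (block_label \<alpha> t i)"
      using block_label_index_le[OF t_pos nonzero[of i]] by (simp add: rsigma_array_def block_label_def)
    then show "block_label \<alpha> t i \<in> F"
      by (rule cover)
  qed
  have "{i. \<beta> i \<noteq> 0} \<subseteq> (\<Union>k\<in>fst ` F. dyadic_block k)"
    using labels by (force simp: block_label_def in_dyadic_block_iff)
  then have support: "finite {i. \<beta> i \<noteq> 0}"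
    by (rule finite_subset) (use cardinality in auto)
  have rank: "card (block_label \<alpha> t ` {i. \<beta> i \<noteq> 0}) \<le> n"
    using card_mono[OF cardinality(1) labels] cardinality(2) by simp
  show ?thesis
    unfolding \<beta>_def[symmetric]
  proof (rule approx_num_rhaly_le_labelled[OF _ support rank])
    show "block_label \<alpha> t j = block_label \<alpha> t l"
      if "i \<le> j" "j \<le> l" "block_label \<alpha> t i = block_label \<alpha> t l" for i j l
      using t_pos that by (rule block_label_convex)
    show "real (j - i) * (\<Sum>l\<in>{i<..j}. (cmod (\<beta> l))\<^sup>2) \<le> t\<^sup>2"
      if "i \<le> j" "block_label \<alpha> t i = block_label \<alpha> t j" for i j
      unfolding \<beta>_def using t_pos that by (rule block_label_mass_restrict_le)
  qed (use t_pos in simp)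
qed

lemma approx_num_rhaly_le:
  assumes t_pos: "0 < t" and cardinality: "finite F" "card F \<le> n" and cover: "\<And>x. t \<le> rsigma_array \<alpha> x \<Longrightarrow> x \<in> F"
  shows "approx_num (rhaly \<alpha>) n \<le> ennreal (5 * t)"
proof -
  let ?Q = "\<lambda>k. t \<le> rsigma_seq \<alpha> k"
  have "approx_num (rhaly \<alpha>) n \<le>
      opnorm (rhaly (restrict_blocks (\<lambda>k. \<not> ?Q k) \<alpha>)) + approx_num (rhaly (restrict_blocks ?Q \<alpha>)) n"
    using approx_num_add_le rhaly_restrict_blocks_add[of \<alpha> _ _ ?Q] by (metis (no_types, lifting) ext)
  also have "\<dots> \<le> ennreal (4 * t) + ennreal t"
    using t_pos by (intro add_mono opnorm_rhaly_le approx_num_rhaly_large_blocks_le[OF t_pos cardinality cover])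
      (simp_all add: rsigma_seq_restrict_blocks)
  also have "\<dots> = ennreal (5 * t)"
    using t_pos by (simp add: ennreal_plus[symmetric] del: ennreal_plus)
  finally show ?thesis .
qed

lemma ex_rsigma_array_ge_approx_num:
  assumes "finite F"
  shows "\<exists>x. x \<notin> F \<and> enn2real (approx_num (rhaly \<alpha>) (card F)) / 10 \<le> rsigma_array \<alpha> x"
proof (rule ccontr)
  define t where "t = enn2real (approx_num (rhaly \<alpha>) (card F)) / 10"
  assume "\<nexists>x. x \<notin> F \<and> enn2real (approx_num (rhaly \<alpha>) (card F)) / 10 \<le> rsigma_array \<alpha> x"
  then have none: "x \<notin> F \<Longrightarrow> rsigma_array \<alpha> x < t" for x
    by (cases x) (auto simp: t_def not_le)
  obtain x where "x \<notin> F"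
    using assms ex_new_if_finite[of F] by (auto simp: finite_prod)
  moreover have "0 \<le> rsigma_array \<alpha> x"
    by (cases x) (simp add: rsigma_array_def rsigma_seq_nonneg)
  ultimately have "0 < t"
    using none[of x] by linarith
  then have "approx_num (rhaly \<alpha>) (card F) \<le> ennreal (5 * t)"
    using none by (intro approx_num_rhaly_le[OF _ assms]) force+
  then have "enn2real (approx_num (rhaly \<alpha>) (card F)) \<le> 5 * t"
    using \<open>0 < t\<close> by (intro enn2real_leI) auto
  with \<open>0 < t\<close> show False
    by (simp add: t_def)
qed

lemma sum_rsigma_array_powr_le:
  assumes "summable (\<lambda>k. rsigma_seq \<alpha> k powr q)" "1 < q" "finite F"
  shows "(\<Sum>x\<in>F. rsigma_array \<alpha> x powr q) \<le>
    (\<Sum>k. 3 powr q * rsigma_seq \<alpha> k powr q) * (\<Sum>m. real (m+1) powr - q)"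
proof -
  have "summable (\<lambda>m. real m powr - q)"
    using \<open>1 < q\<close> by (simp add: summable_real_powr_iff)
  then have "summable (\<lambda>m. real (m+1) powr - q)"
    using summable_iff_shift[of "\<lambda>m. real m powr - q" 1] by simp
  moreover have "(\<Sum>x\<in>F. rsigma_array \<alpha> x powr q) =
      (\<Sum>(k, m)\<in>F. 3 powr q * rsigma_seq \<alpha> k powr q * real (m+1) powr - q)"
    by (intro sum.cong)
      (auto simp: rsigma_array_def rsigma_seq_nonneg powr_divide powr_mult powr_minus_divide)
  ultimately show ?thesis
    using assms by (simp add: sum_prod_le_suminf_mult summable_mult)
qed

lemma schatten_if_summable_rsigma_seq:
  assumes sigma_summable: "summable (\<lambda>k. rsigma_seq \<alpha> k powr q)" and exponent: "1 < q"
  shows "schatten q (rhaly \<alpha>)"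
proof -
  define a where "a n = enn2real (approx_num (rhaly \<alpha>) n)" for n
  have "approx_num (rhaly \<alpha>) n < \<infinity>" for n
  proof -
    have "rsigma_seq \<alpha> k \<le> (\<Sum>k. rsigma_seq \<alpha> k powr q) powr (1/q)" for k
      using sigma_summable exponent by (intro le_suminf_powr rsigma_seq_nonneg) auto
    then have "opnorm (rhaly \<alpha>) \<le> ennreal (4 * (\<Sum>k. rsigma_seq \<alpha> k powr q) powr (1/q))"
      by (rule opnorm_rhaly_le)
    also have "\<dots> < \<infinity>"
      by simp
    finally show ?thesis
      by (rule le_less_trans[OF approx_num_le_opnorm])
  qed
  moreover have "summable (\<lambda>n. (a n / 10) powr q)"
  proof (rule summable_if_dominated_by_rearrangement)
    show "\<exists>x. x \<notin> F \<and> (a (card F) / 10) powr q \<le> rsigma_array \<alpha> x powr q" if finite_F: "finite F" for F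
    proof -
      obtain x where "x \<notin> F" and large: "a (card F) / 10 \<le> rsigma_array \<alpha> x"
        unfolding a_def using ex_rsigma_array_ge_approx_num[OF finite_F] by blast
      have "(a (card F) / 10) powr q \<le> rsigma_array \<alpha> x powr q"
        using exponent by (intro powr_mono2 large) (simp_all add: a_def)
      with \<open>x \<notin> F\<close> show ?thesis
        by blast
    qed
    show "(\<Sum>x\<in>F. rsigma_array \<alpha> x powr q) \<le>
        (\<Sum>k. 3 powr q * rsigma_seq \<alpha> k powr q) * (\<Sum>m. real (m+1) powr - q)" if "finite F" for F
      using sigma_summable exponent that by (rule sum_rsigma_array_powr_le)
  qed simp
  then have "summable (\<lambda>n. 10 powr q * (a n / 10) powr q)"
    by (rule summable_mult)
  then have "summable (\<lambda>n. a n powr q)"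
    by (simp add: powr_divide a_def)
  ultimately show ?thesis
    by (simp add: schatten_def a_def)
qed

theorem theorem5p8:
  fixes \<alpha> :: "nat \<Rightarrow> complex" and q :: real
  assumes "\<alpha> \<in> l2" and "1 < q"
  shows "schatten q (rhaly \<alpha>) \<longleftrightarrow> summable (\<lambda>k. (rsigma_seq \<alpha> k) powr q)"
proof
  assume "schatten q (rhaly \<alpha>)"
  then show "summable (\<lambda>k. rsigma_seq \<alpha> k powr q)"
    using \<open>1 < q\<close> by (intro summable_rsigma_seq_if_schatten) simp_all
next
  assume "summable (\<lambda>k. rsigma_seq \<alpha> k powr q)"
  then show "schatten q (rhaly \<alpha>)"
    using \<open>1 < q\<close> by (rule schatten_if_summable_rsigma_seq)
qed

end
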